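(* Let $\mathcal{M}'=\langle S,L,\tau_\epsilon,\ell\rangle$ be a labelled Markov chain and $\epsilon_2>0$ a compression parameter. Let $(\mathcal{Q}_i)_i$ be the sequence of labelled Markov chains produced on input $(\mathcal{M}',\epsilon_2)$ either by the minimisation algorithm using local bisimilarity distances or by the minimisation algorithm using approximate partition refinement (both described in the context). Then for all $i\in\mathbb{N}$ (for which the chains in question are produced), $\mathcal{Q}_{i+1}$ is an $\epsilon_2$-quotient of $\mathcal{Q}_i$. Furthermore, $\mathcal{Q}_i$ is an $i\epsilon_2$-quotient of $\mathcal{M}'$.
   Context: A labelled Markov chain (LMC) is a quadruple $\langle S,L,\tau,\ell\rangle$ with $S$ a nonempty finite set of states, $L$ a nonempty finite set of labels, $\tau:S\to\mathrm{Distr}(S)$ a transition function ($\mathrm{Distr}(S)$ is the set of probability distributions on $S$), and $\ell:S\to L$ a labelling function. For $E\subseteq S$ write $\tau(s)(E)=\sum_{t\in E}\tau(s)(t)$. $\|\cdot\|_1$ is the $L_1$-norm. An equivalence relation $\mathcal{R}\subseteq S\times S$ is a probabilistic bisimulation if for all $(s,t)\in\mathcal{R}$ we have $\ell(s)=\ell(t)$ and $\tau(s)(E)=\tau(t)(E)$ for each $\mathcal{R}$-equivalence class $E$. Probabilistic bisimilarity $\sim_{\mathcal{M}}$ is the largest probabilistic bisimulation on $\mathcal{M}$. A probabilistic bisimulation $\mathcal{R}$ induces the quotient LMC $\mathcal{M}/_{\mathcal{R}}=\langle S/_{\mathcal{R}},L,\tau/_{\mathcal{R}},\ell/_{\mathcal{R}}\rangle$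 with $\tau/_{\mathcal{R}}([s])([t])=\tau(s)([t])$ and $\ell/_{\mathcal{R}}([s])=\ell(s)$. For $\epsilon\ge 0$, an LMC $\mathcal{Q}$ is an $\epsilon$-quotient of $\mathcal{M}=\langle S,L,\tau,\ell\rangle$ if there is a transition function $\tau':S\to\mathrm{Distr}(S)$ with $\|\tau'(s)-\tau(s)\|_1\le\epsilon$ for all $s\in S$ such that $\mathcal{Q}$ is (up to isomorphism, i.e. renaming of states) the bisimulation quotient $\mathcal{N}/_{\sim_{\mathcal{N}}}$ of $\mathcal{N}=\langle S,L,\tau',\ell\rangle$. Local bisimilarity distance: for an LMC $\mathcal{M}=\langle S,L,\tau,\ell\rangle$ and $s\ne t$ in $S$ with $\ell(s)=\ell(t)$, let $\mathrm{T}$ be the set of transition functions $\tau'$ on $S$ with $\tau'(x)=\tau(x)$ for all $x\notin\{s,t\}$ and such that $\{s,t\}\in S/_{\mathcal{R}}$ for some probabilistic bisimulation $\mathcal{R}$ of $\langle S,L,\tau',\ell\rangle$; then $d_{\mathrm{local}}^{\mathcal{M}}(s,t)=\inf_{\tau'\in\mathrm{T}}\max\{\|\tau'(s)-\tau(s)\|_1,\|\tau'(t)-\tau(t)\|_1\}$. The partition of $S$ associated with $(s,t)$ is $S/_{\sim_{\mathcal{M}''}}$, where $\mathcal{M}''$ is obtained from $\mathcal{M}$ by giving $s$ and $t$ (only) a common new label and making both absorbing (self-loop with probability $1$); it contains $\{s,t\}$ as a block. Write $\mathcal{Q}_i=\langle S^{\mathcal{Q}_i},L,\tau^{\mathcal{Q}_i},\ell^{\mathcal{Q}_i}\rangle$.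 Both algorithms start with $\mathcal{Q}_0=\mathcal{M}'/_{\sim_{\mathcal{M}'}}$. Minimisation using local bisimilarity distances: while there are $u\ne v$ in $S^{\mathcal{Q}_i}$ with equal labels and $d_{\mathrm{local}}^{\mathcal{Q}_i}(u,v)\le\epsilon_2$, choose $(s,t)$ minimising $d_{\mathrm{local}}^{\mathcal{Q}_i}$ among pairs of different states with equal labels; let $X_i$ be the partition of $S^{\mathcal{Q}_i}$ associated with $(s,t)$; let $\mathcal{M}_{i+1}$ be the LMC with state space $X_i$, where a block $E\ne\{s,t\}$ has transition distribution $(\tau^{\mathcal{Q}_i}(u)(E'))_{E'\in X_i}$ for any $u\in E$, the block $\{s,t\}$ has transition distribution $\frac12\big((\tau^{\mathcal{Q}_i}(s)(E'))_{E'\in X_i}+(\tau^{\mathcal{Q}_i}(t)(E'))_{E'\in X_i}\big)$, and the label of $E$ is $\ell^{\mathcal{Q}_i}(u)$ for any $u\in E$; set $\mathcal{Q}_{i+1}=\mathcal{M}_{i+1}/_{\sim_{\mathcal{M}_{i+1}}}$ and increment $i$. Approximate partition refinement, on an LMC $\langle S,L,\tau,\ell\rangle$ with parameter $\epsilon_2$: let $Y_0=\{S\}$. For $j=1,2,\dots$ compute $Y_j$ from $Y_{j-1}$ as follows, until $Y_j=Y_{j-1}$, and output this final partition. For each $E\in Y_{j-1}$, build a partition $X_E$ of $E$, starting with $X_E=\emptyset$ and processing the states $s\in E$ one by one (in arbitrary order): let $ESet$ be the set of $E'\in X_E$ such that for all $t\in E'$ we have $\ell(s)=\ell(t)$ and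 $\|(\tau(s)(F))_{F\in Y_{j-1}}-(\tau(t)(F))_{F\in Y_{j-1}}\|_1\le\epsilon_2$; if $ESet=\emptyset$, add $\{s\}$ to $X_E$; otherwise choose $E'\in ESet$ minimising the average $\frac{1}{|E'|}\sum_{t\in E'}\|(\tau(s)(F))_{F\in Y_{j-1}}-(\tau(t)(F))_{F\in Y_{j-1}}\|_1$ and replace $E'$ by $E'\cup\{s\}$ in $X_E$. Then $Y_j=\bigcup_{E\in Y_{j-1}}X_E$. Minimisation using approximate partition refinement: repeat the following until $|S^{\mathcal{Q}_{i}}|=|S^{\mathcal{Q}_{i-1}}|$ (tested after each round): let $X_i$ be the output of approximate partition refinement on $\mathcal{Q}_i$ with $\epsilon_2$; let $\mathcal{M}_{i+1}$ be the LMC with state space $X_i$, transition function $E\mapsto\frac{1}{|E|}\sum_{u\in E}(\tau^{\mathcal{Q}_i}(u)(E'))_{E'\in X_i}$ and label $\ell^{\mathcal{Q}_i}(x)$ of $E$ for any $x\in E$; set $\mathcal{Q}_{i+1}=\mathcal{M}_{i+1}/_{\sim_{\mathcal{M}_{i+1}}}$ and increment $i$. *)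

theory Defs
  imports "HOL-Probability.Probability"
begin

section \<open>Labelled Markov chains and probabilistic bisimilarity\<close>

text \<open>
  The components \<open>tau\<close> and \<open>lbl\<close> are total functions; only their values on \<open>states\<close> are
  meaningful.
\<close>

record ('s, 'l) lmc =
  states :: "'s set"
  labels :: "'l set"
  tau    :: "'s \<Rightarrow> 's pmf"
  lbl    :: "'s \<Rightarrow> 'l"

definition transition_function :: "'s set \<Rightarrow> ('s \<Rightarrow> 's pmf) \<Rightarrow> bool" where
  "transition_function S \<tau> \<longleftrightarrow> (\<forall>s\<in>S. set_pmf (\<tau> s) \<subseteq> S)"

definition is_lmc :: "('s, 'l) lmc \<Rightarrow> bool" where
  "is_lmc M \<longleftrightarrow>
     finite (states M) \<and> states M \<noteq> {} \<and>
     finite (labels M) \<and> labels M \<noteq> {} \<and>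
     transition_function (states M) (tau M) \<and>
     (\<forall>s\<in>states M. lbl M s \<in> labels M)"

definition prob_bisim :: "('s, 'l) lmc \<Rightarrow> ('s \<times> 's) set \<Rightarrow> bool" where
  "prob_bisim M R \<longleftrightarrow>
     equiv (states M) R \<and>
     (\<forall>(s, t)\<in>R. lbl M s = lbl M t \<and>
        (\<forall>E\<in>states M // R. measure_pmf.prob (tau M s) E = measure_pmf.prob (tau M t) E))"

text \<open>The largest probabilistic bisimulation; it exists by \<open>bisimilarity_largest\<close> below.\<close>

definition bisimilarity :: "('s, 'l) lmc \<Rightarrow> ('s \<times> 's) set" where
  "bisimilarity M = (GREATEST R. prob_bisim M R)"

text \<open>
  The representative chosen by \<open>SOME\<close> is immaterial when \<open>R\<close> is a probabilistic bisimulation,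
  see \<open>quotient_lmc_tau\<close> and \<open>quotient_lmc_lbl\<close> below.
\<close>

definition quotient_lmc :: "('s, 'l) lmc \<Rightarrow> ('s \<times> 's) set \<Rightarrow> ('s set, 'l) lmc" where
  "quotient_lmc M R =
     \<lparr> states = states M // R,
       labels = labels M,
       tau = (\<lambda>E. map_pmf (\<lambda>t. R `` {t}) (tau M (SOME s. s \<in> E))),
       lbl = (\<lambda>E. lbl M (SOME s. s \<in> E)) \<rparr>"

abbreviation bisim_quotient :: "('s, 'l) lmc \<Rightarrow> ('s set, 'l) lmc" where
  "bisim_quotient M \<equiv> quotient_lmc M (bisimilarity M)"

definition lmc_iso :: "('s, 'l) lmc \<Rightarrow> ('t, 'l) lmc \<Rightarrow> bool" where
  "lmc_iso M N \<longleftrightarrow>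
     labels N = labels M \<and>
     (\<exists>f. bij_betw f (states M) (states N) \<and>
        (\<forall>s\<in>states M. tau N (f s) = map_pmf f (tau M s) \<and> lbl N (f s) = lbl M s))"

section \<open>Approximate quotients\<close>

definition l1_dist :: "'s set \<Rightarrow> 's pmf \<Rightarrow> 's pmf \<Rightarrow> real" where
  "l1_dist S p q = (\<Sum>x\<in>S. \<bar>pmf p x - pmf q x\<bar>)"

definition eps_quotient :: "real \<Rightarrow> ('t, 'l) lmc \<Rightarrow> ('s, 'l) lmc \<Rightarrow> bool" where
  "eps_quotient \<epsilon> Q M \<longleftrightarrow>
     0 \<le> \<epsilon> \<and> is_lmc Q \<and>
     (\<exists>\<tau>'. transition_function (states M) \<tau>' \<and>
        (\<forall>s\<in>states M. l1_dist (states M) (\<tau>' s) (tau M s) \<le> \<epsilon>) \<and>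
        lmc_iso (bisim_quotient (M\<lparr>tau := \<tau>'\<rparr>)) Q)"

section \<open>Distributions on the blocks of a partition\<close>

text \<open>
  If \<open>X\<close> is a partition of a set supporting \<open>p\<close>, then \<open>lump X p\<close> is the distribution
  \<open>(p(E))\<close> for \<open>E \<in> X\<close>, see \<open>pmf_lump\<close> below.
\<close>

definition lump :: "'s set set \<Rightarrow> 's pmf \<Rightarrow> 's set pmf" where
  "lump X p = map_pmf (\<lambda>x. THE E. E \<in> X \<and> x \<in> E) p"

text \<open>The uniform average of the distributions \<open>f u\<close> for \<open>u \<in> A\<close>, see \<open>pmf_average\<close> below.\<close>

definition average_pmf :: "'a set \<Rightarrow> ('a \<Rightarrow> 'b pmf) \<Rightarrow> 'b pmf" where
  "average_pmf A f = bind_pmf (pmf_of_set A) f"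

definition block_dist :: "'s set set \<Rightarrow> 's pmf \<Rightarrow> 's pmf \<Rightarrow> real" where
  "block_dist X p q = (\<Sum>F\<in>X. \<bar>measure_pmf.prob p F - measure_pmf.prob q F\<bar>)"

section \<open>Minimisation using local bisimilarity distances\<close>

definition local_modifications :: "('s, 'l) lmc \<Rightarrow> 's \<Rightarrow> 's \<Rightarrow> ('s \<Rightarrow> 's pmf) set" where
  "local_modifications M s t =
     {\<tau>'. transition_function (states M) \<tau>' \<and>
          (\<forall>x\<in>states M - {s, t}. \<tau>' x = tau M x) \<and>
          (\<exists>R. prob_bisim (M\<lparr>tau := \<tau>'\<rparr>) R \<and> {s, t} \<in> states M // R)}"

definition d_local :: "('s, 'l) lmc \<Rightarrow> 's \<Rightarrow> 's \<Rightarrow> real" where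
  "d_local M s t =
     (INF \<tau>'\<in>local_modifications M s t.
        max (l1_dist (states M) (\<tau>' s) (tau M s)) (l1_dist (states M) (\<tau>' t) (tau M t)))"

text \<open>\<open>None\<close> serves as the new label.\<close>

definition absorbing_lmc :: "('s, 'l) lmc \<Rightarrow> 's \<Rightarrow> 's \<Rightarrow> ('s, 'l option) lmc" where
  "absorbing_lmc M s t =
     \<lparr> states = states M,
       labels = insert None (Some ` labels M),
       tau = (tau M)(s := return_pmf s, t := return_pmf t),
       lbl = (\<lambda>x. if x \<in> {s, t} then None else Some (lbl M x)) \<rparr>"

definition local_partition :: "('s, 'l) lmc \<Rightarrow> 's \<Rightarrow> 's \<Rightarrow> 's set set" where
  "local_partition M s t = states M // bisimilarity (absorbing_lmc M s t)"

text \<open>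
  For \<open>E \<noteq> {s, t}\<close> the representative chosen by \<open>SOME\<close> is immaterial, see
  \<open>local_merge_other_block\<close> below.
\<close>

definition local_merge :: "('s, 'l) lmc \<Rightarrow> 's \<Rightarrow> 's \<Rightarrow> ('s set, 'l) lmc" where
  "local_merge M s t = (let X = local_partition M s t in
     \<lparr> states = X,
       labels = labels M,
       tau = (\<lambda>E. if E = {s, t} then average_pmf {s, t} (\<lambda>u. lump X (tau M u))
                  else lump X (tau M (SOME u. u \<in> E))),
       lbl = (\<lambda>E. lbl M (SOME u. u \<in> E)) \<rparr>)"

definition candidate_pairs :: "('s, 'l) lmc \<Rightarrow> ('s \<times> 's) set" where
  "candidate_pairs M = {(u, v) \<in> states M \<times> states M. u \<noteq> v \<and> lbl M u = lbl M v}"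

definition local_step :: "real \<Rightarrow> ('s, 'l) lmc \<Rightarrow> ('t, 'l) lmc \<Rightarrow> bool" where
  "local_step \<epsilon> Q Q' \<longleftrightarrow>
     (\<exists>(u, v)\<in>candidate_pairs Q. d_local Q u v \<le> \<epsilon>) \<and>
     (\<exists>(s, t)\<in>candidate_pairs Q.
        (\<forall>(u, v)\<in>candidate_pairs Q. d_local Q s t \<le> d_local Q u v) \<and>
        lmc_iso (bisim_quotient (local_merge Q s t)) Q')"

text \<open>
  \<open>Q 0, \<dots>, Q n\<close> are the first \<open>n + 1\<close> chains of a run. Quotienting changes the type of states,
  so each chain is represented by an isomorphic copy over a common type.
\<close>

definition local_run :: "real \<Rightarrow> ('s, 'l) lmc \<Rightarrow> nat \<Rightarrow> (nat \<Rightarrow> ('q, 'l) lmc) \<Rightarrow> bool" where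
  "local_run \<epsilon> M n Q \<longleftrightarrow>
     lmc_iso (bisim_quotient M) (Q 0) \<and>
     (\<forall>i<n. local_step \<epsilon> (Q i) (Q (Suc i)))"

section \<open>Minimisation using approximate partition refinement\<close>

definition apr_compatible :: "('s, 'l) lmc \<Rightarrow> real \<Rightarrow> 's set set \<Rightarrow> 's \<Rightarrow> 's set set \<Rightarrow> 's set set" where
  "apr_compatible M \<epsilon> Y s XE =
     {E'\<in>XE. \<forall>t\<in>E'. lbl M s = lbl M t \<and> block_dist Y (tau M s) (tau M t) \<le> \<epsilon>}"

definition apr_average :: "('s, 'l) lmc \<Rightarrow> 's set set \<Rightarrow> 's \<Rightarrow> 's set \<Rightarrow> real" where
  "apr_average M Y s E' = (1 / real (card E')) * (\<Sum>t\<in>E'. block_dist Y (tau M s) (tau M t))"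

definition apr_insert ::
  "('s, 'l) lmc \<Rightarrow> real \<Rightarrow> 's set set \<Rightarrow> 's \<Rightarrow> 's set set \<Rightarrow> 's set set \<Rightarrow> bool" where
  "apr_insert M \<epsilon> Y s XE XE' \<longleftrightarrow> (let ESet = apr_compatible M \<epsilon> Y s XE in
     if ESet = {} then XE' = insert {s} XE
     else \<exists>E'\<in>ESet. (\<forall>E''\<in>ESet. apr_average M Y s E' \<le> apr_average M Y s E'') \<and>
            XE' = insert (E' \<union> {s}) (XE - {E'}))"

inductive apr_process ::
  "('s, 'l) lmc \<Rightarrow> real \<Rightarrow> 's set set \<Rightarrow> 's list \<Rightarrow> 's set set \<Rightarrow> 's set set \<Rightarrow> bool"
  for M \<epsilon> Y where
  empty: "apr_process M \<epsilon> Y [] XE XE"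
| insert: "apr_insert M \<epsilon> Y s XE XE' \<Longrightarrow> apr_process M \<epsilon> Y ss XE' XE'' \<Longrightarrow>
         apr_process M \<epsilon> Y (s # ss) XE XE''"

definition apr_split :: "('s, 'l) lmc \<Rightarrow> real \<Rightarrow> 's set set \<Rightarrow> 's set \<Rightarrow> 's set set \<Rightarrow> bool" where
  "apr_split M \<epsilon> Y E XE \<longleftrightarrow> (\<exists>ss. distinct ss \<and> set ss = E \<and> apr_process M \<epsilon> Y ss {} XE)"

definition apr_refine :: "('s, 'l) lmc \<Rightarrow> real \<Rightarrow> 's set set \<Rightarrow> 's set set \<Rightarrow> bool" where
  "apr_refine M \<epsilon> Y Y' \<longleftrightarrow>
     (\<exists>X. (\<forall>E\<in>Y. apr_split M \<epsilon> Y E (X E)) \<and> Y' = (\<Union>E\<in>Y. X E))"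

inductive apr_loop :: "('s, 'l) lmc \<Rightarrow> real \<Rightarrow> 's set set \<Rightarrow> 's set set \<Rightarrow> bool"
  for M \<epsilon> where
  stop: "apr_refine M \<epsilon> Y Y' \<Longrightarrow> Y' = Y \<Longrightarrow> apr_loop M \<epsilon> Y Y'"
| continue: "apr_refine M \<epsilon> Y Y' \<Longrightarrow> Y' \<noteq> Y \<Longrightarrow> apr_loop M \<epsilon> Y' Z \<Longrightarrow> apr_loop M \<epsilon> Y Z"

definition apr_output :: "('s, 'l) lmc \<Rightarrow> real \<Rightarrow> 's set set \<Rightarrow> bool" where
  "apr_output M \<epsilon> X \<longleftrightarrow> apr_loop M \<epsilon> {states M} X"

definition apr_merge :: "('s, 'l) lmc \<Rightarrow> 's set set \<Rightarrow> ('s set, 'l) lmc" where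
  "apr_merge M X =
     \<lparr> states = X,
       labels = labels M,
       tau = (\<lambda>E. average_pmf E (\<lambda>u. lump X (tau M u))),
       lbl = (\<lambda>E. lbl M (SOME x. x \<in> E)) \<rparr>"

definition apr_step :: "real \<Rightarrow> ('s, 'l) lmc \<Rightarrow> ('t, 'l) lmc \<Rightarrow> bool" where
  "apr_step \<epsilon> Q Q' \<longleftrightarrow>
     (\<exists>X. apr_output Q \<epsilon> X \<and> lmc_iso (bisim_quotient (apr_merge Q X)) Q')"

text \<open>
  The first round is always executed; a further round is executed only if the previous one
  changed the number of states.
\<close>

definition apr_run :: "real \<Rightarrow> ('s, 'l) lmc \<Rightarrow> nat \<Rightarrow> (nat \<Rightarrow> ('q, 'l) lmc) \<Rightarrow> bool" where
  "apr_run \<epsilon> M n Q \<longleftrightarrow>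
     lmc_iso (bisim_quotient M) (Q 0) \<and>
     (\<forall>i<n. apr_step \<epsilon> (Q i) (Q (Suc i))) \<and>
     (\<forall>i. Suc i < n \<longrightarrow> card (states (Q (Suc i))) \<noteq> card (states (Q i)))"

section \<open>Well-definedness\<close>

lemma prob_bisim_closed_set:
  assumes fin: "finite (states M)" and b: "prob_bisim M R" and st: "(s, t) \<in> R"
    and E: "E \<subseteq> states M" "R `` E \<subseteq> E"
  shows "measure_pmf.prob (tau M s) E = measure_pmf.prob (tau M t) E"
proof -
  have eq: "equiv (states M) R" using b by (simp add: prob_bisim_def)
  define C where "C = {D \<in> states M // R. D \<subseteq> E}"
  have "R \<subseteq> states M \<times> states M" using eq by (simp add: equiv_def)
  then have finC: "finite C"
    unfolding C_def using fin finite_quotient[of "states M" R] by simp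
  have U: "\<Union>C = E"
  proof
    show "\<Union>C \<subseteq> E" by (auto simp: C_def)
    show "E \<subseteq> \<Union>C"
    proof
      fix x assume x: "x \<in> E"
      then have xs: "x \<in> states M" using E by blast
      have "R `` {x} \<in> C" using x xs E by (auto simp: C_def quotientI)
      moreover have "x \<in> R `` {x}" using equiv_class_self[OF eq xs] .
      ultimately show "x \<in> \<Union>C" by blast
    qed
  qed
  have disj: "disjoint_family_on (\<lambda>D. D) C"
    unfolding disjoint_family_on_def C_def using quotient_disj[OF eq] by blast
  have sum: "measure_pmf.prob p E = (\<Sum>D\<in>C. measure_pmf.prob p D)" for p :: "'a pmf"
    using measure_pmf.finite_measure_finite_Union[OF finC _ disj, of p] U by simp
  have "measure_pmf.prob (tau M s) D = measure_pmf.prob (tau M t) D" if "D \<in> C" for D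
    using b st that by (auto simp: prob_bisim_def C_def)
  then show ?thesis unfolding sum by (intro sum.cong) auto
qed

lemma prob_bisim_Id: "prob_bisim M (Id_on (states M))"
  by (auto simp: prob_bisim_def equiv_def refl_on_def sym_def trans_def)

theorem bisimilarity_largest:
  assumes fin: "finite (states M)"
  shows "prob_bisim M (bisimilarity M)"
    and "prob_bisim M R \<Longrightarrow> R \<subseteq> bisimilarity M"
proof -
  define U where "U = \<Union>{R. prob_bisim M R}"
  have Uin: "U \<subseteq> states M \<times> states M" by (auto simp: U_def prob_bisim_def equiv_def)
  have symU: "sym U"
    unfolding U_def sym_def by (auto simp: prob_bisim_def equiv_def sym_def)
  have "refl_on (states M) (U\<^sup>+)"
    unfolding refl_on_def
    using prob_bisim_Id[of M] by (auto simp: U_def intro!: r_into_trancl)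
  then have eq: "equiv (states M) (U\<^sup>+)"
    using trancl_subset_Sigma[OF Uin] sym_trancl[OF symU] by (auto simp: equiv_def)
  have one: "lbl M s = lbl M t \<and>
      (\<forall>E\<in>states M // U\<^sup>+. measure_pmf.prob (tau M s) E = measure_pmf.prob (tau M t) E)"
    if "(s, t) \<in> U" for s t
  proof -
    from that obtain R where R: "prob_bisim M R" "(s, t) \<in> R" by (auto simp: U_def)
    have RU: "R \<subseteq> U\<^sup>+" using R(1) by (auto simp: U_def)
    have "measure_pmf.prob (tau M s) E = measure_pmf.prob (tau M t) E"
      if E: "E \<in> states M // U\<^sup>+" for E
    proof (rule prob_bisim_closed_set[OF fin R])
      show "E \<subseteq> states M" using E eq in_quotient_imp_subset by blast
      show "R `` E \<subseteq> E" using RU in_quotient_imp_closed[OF eq E] by blast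
    qed
    moreover have "lbl M s = lbl M t" using R by (auto simp: prob_bisim_def)
    ultimately show ?thesis by blast
  qed
  have "lbl M s = lbl M t \<and>
      (\<forall>E\<in>states M // U\<^sup>+. measure_pmf.prob (tau M s) E = measure_pmf.prob (tau M t) E)"
    if "(s, t) \<in> U\<^sup>+" for s t
    using that by (induction rule: trancl_induct) (use one in auto)
  then have b: "prob_bisim M (U\<^sup>+)" using eq by (auto simp: prob_bisim_def)
  have g: "R \<subseteq> U\<^sup>+" if "prob_bisim M R" for R using that by (auto simp: U_def)
  have "bisimilarity M = U\<^sup>+"
    unfolding bisimilarity_def using b g by (intro Greatest_equality) auto
  then show "prob_bisim M (bisimilarity M)" and "prob_bisim M R \<Longrightarrow> R \<subseteq> bisimilarity M"
    using b g by auto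
qed

lemma prob_class_eq_pmf:
  assumes eq: "equiv S R" and p: "set_pmf p \<subseteq> S" and t: "t \<in> S"
  shows "pmf (map_pmf (\<lambda>x. R `` {x}) p) (R `` {t}) = measure_pmf.prob p (R `` {t})"
proof -
  have "measure_pmf.prob p ((\<lambda>x. R `` {x}) -` {R `` {t}}) = measure_pmf.prob p (R `` {t})"
  proof (rule measure_prob_cong_0)
    fix x assume "x \<in> (\<lambda>x. R `` {x}) -` {R `` {t}} - R `` {t}"
    then have "x \<notin> S" using equiv_class_self[OF eq] by blast
    then show "pmf p x = 0" using p by (auto simp: pmf_eq_0_set_pmf)
  next
    fix x assume "x \<in> R `` {t} - (\<lambda>x. R `` {x}) -` {R `` {t}}"
    then show "pmf p x = 0" using equiv_class_eq[OF eq] by blast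
  qed
  then show ?thesis by (simp add: pmf_map)
qed

lemma some_in_class:
  assumes "equiv S R" "s \<in> S"
  shows "(s, SOME x. x \<in> R `` {s}) \<in> R"
  using someI[of "\<lambda>x. x \<in> R `` {s}" s] equiv_class_self[OF assms] by simp

lemma quotient_lmc_tau:
  assumes M: "is_lmc M" and b: "prob_bisim M R" and s: "s \<in> states M" and t: "t \<in> states M"
  shows "pmf (tau (quotient_lmc M R) (R `` {s})) (R `` {t}) = measure_pmf.prob (tau M s) (R `` {t})"
proof -
  define s' where "s' = (SOME x. x \<in> R `` {s})"
  have eq: "equiv (states M) R" using b by (simp add: prob_bisim_def)
  have r: "(s, s') \<in> R" unfolding s'_def by (rule some_in_class[OF eq s])
  then have "s' \<in> states M" using eq by (auto simp: equiv_def)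
  then have "set_pmf (tau M s') \<subseteq> states M" using M by (auto simp: is_lmc_def transition_function_def)
  then have "pmf (tau (quotient_lmc M R) (R `` {s})) (R `` {t}) = measure_pmf.prob (tau M s') (R `` {t})"
    using prob_class_eq_pmf[OF eq _ t] by (simp add: quotient_lmc_def s'_def)
  also have "\<dots> = measure_pmf.prob (tau M s) (R `` {t})"
    using b r quotientI[OF t, of R] by (auto simp: prob_bisim_def)
  finally show ?thesis .
qed

lemma quotient_lmc_lbl:
  assumes b: "prob_bisim M R" and s: "s \<in> states M"
  shows "lbl (quotient_lmc M R) (R `` {s}) = lbl M s"
proof -
  have eq: "equiv (states M) R" using b by (simp add: prob_bisim_def)
  show ?thesis using some_in_class[OF eq s] b by (auto simp: prob_bisim_def quotient_lmc_def)
qed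

lemma pmf_lump:
  assumes X: "partition_on S X" and p: "set_pmf p \<subseteq> S" and E: "E \<in> X"
  shows "pmf (lump X p) E = measure_pmf.prob p E"
proof -
  have the: "(THE E. E \<in> X \<and> x \<in> E) = D" if "D \<in> X" "x \<in> D" for x D
    using that X by (intro the_equality) (auto simp: partition_on_def disjoint_def)
  have "measure_pmf.prob p ((\<lambda>x. THE E. E \<in> X \<and> x \<in> E) -` {E}) = measure_pmf.prob p E"
  proof (rule measure_prob_cong_0)
    fix x assume x: "x \<in> (\<lambda>x. THE E. E \<in> X \<and> x \<in> E) -` {E} - E"
    have "x \<notin> S"
    proof
      assume "x \<in> S"
      then obtain D where "D \<in> X" "x \<in> D" using X by (auto simp: partition_on_def)
      then show False using the[of D x] x by auto
    qed
    then show "pmf p x = 0" using p by (auto simp: pmf_eq_0_set_pmf)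
  next
    fix x assume "x \<in> E - (\<lambda>x. THE E. E \<in> X \<and> x \<in> E) -` {E}"
    then show "pmf p x = 0" using the[OF E] by auto
  qed
  then show ?thesis by (simp add: lump_def pmf_map)
qed

lemma pmf_average:
  assumes "finite A" "A \<noteq> {}"
  shows "pmf (average_pmf A f) x = (\<Sum>u\<in>A. pmf (f u) x) / real (card A)"
  using pmf_bind_pmf_of_set[OF assms(2,1)] by (simp add: average_pmf_def)

lemma local_partition_block:
  assumes M: "is_lmc M" and s: "s \<in> states M" and t: "t \<in> states M"
  shows "{s, t} \<in> local_partition M s t"
proof -
  let ?N = "absorbing_lmc M s t"
  define R where "R = Id_on (states M) \<union> {s, t} \<times> {s, t}"
  have st: "states ?N = states M" by (simp add: absorbing_lmc_def)
  have fin: "finite (states ?N)" using M by (simp add: st is_lmc_def)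
  have eq: "equiv (states M) R"
  proof (rule equivI)
    show "R \<subseteq> states M \<times> states M" using s t by (auto simp: R_def)
    show "refl_on (states M) R" unfolding refl_on_def R_def by blast
    show "sym R" unfolding sym_def R_def by blast
    show "trans R" unfolding trans_def R_def by blast
  qed
  have cl: "measure_pmf.prob (tau ?N x) E = measure_pmf.prob (tau ?N y) E"
    if "(x, y) \<in> R" "E \<in> states M // R" for x y E
  proof (cases "x = y")
    case False
    then have xy: "x \<in> {s, t}" "y \<in> {s, t}" using that by (auto simp: R_def)
    have "(s, t) \<in> R" "(t, s) \<in> R" by (auto simp: R_def)
    then have "s \<in> E \<longleftrightarrow> t \<in> E" using in_quotient_imp_closed[OF eq that(2)] by blast
    then show ?thesis using xy by (auto simp: absorbing_lmc_def indicator_def)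
  qed simp
  have lb: "lbl ?N x = lbl ?N y" if "(x, y) \<in> R" for x y
    using that by (auto simp: R_def absorbing_lmc_def)
  have b: "prob_bisim ?N R"
    unfolding prob_bisim_def st using eq cl lb by blast
  then have sub: "R \<subseteq> bisimilarity ?N" by (rule bisimilarity_largest(2)[OF fin])
  have "lbl ?N s = lbl ?N x" if "(s, x) \<in> bisimilarity ?N" for x
    using bisimilarity_largest(1)[OF fin] that by (auto simp: prob_bisim_def)
  then have "bisimilarity ?N `` {s} \<subseteq> {s, t}"
    by (fastforce simp: absorbing_lmc_def split: if_splits)
  then have "bisimilarity ?N `` {s} = {s, t}" using sub by (auto simp: R_def)
  then show ?thesis using quotientI[OF s, of "bisimilarity ?N"] by (simp add: local_partition_def)
qed

lemma local_merge_other_block: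
  assumes M: "is_lmc M" and s: "s \<in> states M" and t: "t \<in> states M"
    and E: "E \<in> local_partition M s t" "E \<noteq> {s, t}" and u: "u \<in> E"
  shows "E' \<in> local_partition M s t \<Longrightarrow>
           pmf (tau (local_merge M s t) E) E' = measure_pmf.prob (tau M u) E'"
    and "lbl (local_merge M s t) E = lbl M u"
proof -
  let ?N = "absorbing_lmc M s t"
  let ?X = "local_partition M s t"
  have st: "states ?N = states M" by (simp add: absorbing_lmc_def)
  have fin: "finite (states ?N)" using M by (simp add: st is_lmc_def)
  have b: "prob_bisim ?N (bisimilarity ?N)" by (rule bisimilarity_largest(1)[OF fin])
  then have eq: "equiv (states M) (bisimilarity ?N)" by (simp add: prob_bisim_def st)
  have X: "partition_on (states M) ?X"
    unfolding local_partition_def by (rule partition_on_quotient[OF eq])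
  have "E \<inter> {s, t} = {}"
    using disjointD[OF _ E(1) local_partition_block[OF M s t] E(2)] X
    by (simp only: partition_on_def)
  define v where "v = (SOME v. v \<in> E)"
  have v: "v \<in> E" unfolding v_def using u by (rule someI)
  have nst: "u \<notin> {s, t}" "v \<notin> {s, t}" using \<open>E \<inter> {s, t} = {}\<close> u v by auto
  have uv: "(v, u) \<in> bisimilarity ?N"
    using quotient_eq_iff[OF eq _ _ v u] E(1) by (simp add: local_partition_def)
  have "lbl ?N v = lbl ?N u" using b uv by (auto simp: prob_bisim_def)
  then have "lbl M v = lbl M u" using nst by (simp add: absorbing_lmc_def)
  then show "lbl (local_merge M s t) E = lbl M u"
    by (simp add: local_merge_def Let_def v_def)
  assume E': "E' \<in> ?X"
  have "v \<in> states M" using v E(1) X by (auto simp: partition_on_def)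
  then have "set_pmf (tau M v) \<subseteq> states M" using M by (auto simp: is_lmc_def transition_function_def)
  then have "pmf (tau (local_merge M s t) E) E' = measure_pmf.prob (tau M v) E'"
    using E(2) pmf_lump[OF X _ E'] by (simp add: local_merge_def Let_def v_def)
  also have "\<dots> = measure_pmf.prob (tau ?N v) E'" using nst by (simp add: absorbing_lmc_def)
  also have "\<dots> = measure_pmf.prob (tau ?N u) E'"
    using b uv E' by (auto simp: prob_bisim_def st local_partition_def)
  also have "\<dots> = measure_pmf.prob (tau M u) E'" using nst by (simp add: absorbing_lmc_def)
  finally show "pmf (tau (local_merge M s t) E) E' = measure_pmf.prob (tau M u) E'" .
qed

end

theory Submission
  imports Defs
begin

text \<open>
  A chain is a bisimulation quotient of \<open>N\<close> as soon as it has no nontrivial bisimulation and is the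
  image of \<open>N\<close> under a functional bisimulation \<open>g\<close>. Given such a \<open>g\<close> from a modification of \<open>M\<close>
  onto \<open>Q\<close>, every modification of the transition function of \<open>Q\<close> lifts along \<open>g\<close> without increasing
  the \<open>L\<^sub>1\<close>-distance, by redistributing the mass of each fibre proportionally. Hence errors of
  successive approximate quotients add up. For a single step, it is enough that the distribution of a
  merged block over blocks is \<open>\<epsilon>\<^sub>2\<close>-close to that of each of its members. For partition refinement the
  average over a block whose members are pairwise \<open>\<epsilon>\<^sub>2\<close>-close satisfies this; for local bisimilarity
  distances, the block distributions of \<open>s\<close> and \<open>t\<close> are at distance at most twice \<open>d_local\<close>, and the
  midpoint halves this.
\<close>

section \<open>The \<open>L\<^sub>1\<close>-distance\<close>

lemma l1_dist_refl [simp]: "l1_dist S p p = 0"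
  by (simp add: l1_dist_def)

lemma l1_dist_sym: "l1_dist S p q = l1_dist S q p"
  by (simp add: l1_dist_def abs_minus_commute)

lemma l1_dist_triangle: "l1_dist S p r \<le> l1_dist S p q + l1_dist S q r"
  unfolding l1_dist_def sum.distrib[symmetric] by (intro sum_mono) simp

lemma pmf_bind_sum:
  assumes "finite T" "set_pmf p \<subseteq> T"
  shows "pmf (bind_pmf p K) x = (\<Sum>t\<in>T. pmf p t * pmf (K t) x)"
  unfolding pmf_bind using assms by (subst integral_measure_pmf[of T]) auto

text \<open>A Markov kernel contracts the L1-distance: each row \<open>K t\<close> has total mass
  one on \<open>S\<close>, so after bounding by absolute values the sum over \<open>x\<close> leaves
  only the difference of \<open>p\<close> and \<open>q\<close>.\<close>

lemma l1_dist_bind_le: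
  assumes fin: "finite S" "finite T" and p: "set_pmf p \<subseteq> T" and q: "set_pmf q \<subseteq> T"
    and K: "\<And>t. t \<in> T \<Longrightarrow> set_pmf (K t) \<subseteq> S"
  shows "l1_dist S (bind_pmf p K) (bind_pmf q K) \<le> l1_dist T p q"
proof -
  have "l1_dist S (bind_pmf p K) (bind_pmf q K)
      = (\<Sum>x\<in>S. \<bar>\<Sum>t\<in>T. (pmf p t - pmf q t) * pmf (K t) x\<bar>)"
    by (simp add: l1_dist_def pmf_bind_sum[OF fin(2)] p q sum_subtractf left_diff_distrib)
  also have "\<dots> \<le> (\<Sum>x\<in>S. \<Sum>t\<in>T. \<bar>pmf p t - pmf q t\<bar> * pmf (K t) x)"
    by (intro sum_mono order.trans[OF sum_abs]) (simp add: abs_mult)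
  also have "\<dots> = (\<Sum>t\<in>T. \<bar>pmf p t - pmf q t\<bar> * (\<Sum>x\<in>S. pmf (K t) x))"
    by (subst sum.swap) (simp add: sum_distrib_left)
  also have "\<dots> = l1_dist T p q"
    unfolding l1_dist_def using sum_pmf_eq_1[OF fin(1) K] by (intro sum.cong) auto
  finally show ?thesis .
qed

lemma l1_dist_map_le:
  assumes "finite S" "set_pmf p \<subseteq> S" "set_pmf q \<subseteq> S" "finite T" "g ` S \<subseteq> T"
  shows "l1_dist T (map_pmf g p) (map_pmf g q) \<le> l1_dist S p q"
  unfolding map_pmf_def using assms by (intro l1_dist_bind_le) auto

text \<open>
  Let \<open>K t\<close> be \<open>p\<close> conditioned on the fibre of \<open>g\<close> over \<open>t\<close>. Then \<open>p = bind_pmf (map_pmf g p) K\<close>,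
  and \<open>bind_pmf q K\<close> is a lift of \<open>q\<close> that is as close to \<open>p\<close> as \<open>q\<close> is to \<open>map_pmf g p\<close>.
\<close>

lemma l1_dist_lift:
  assumes fin: "finite S" and p: "set_pmf p \<subseteq> S" and q: "set_pmf q \<subseteq> g ` S"
  obtains p' where "set_pmf p' \<subseteq> S" "map_pmf g p' = q"
    "l1_dist S p' p \<le> l1_dist (g ` S) q (map_pmf g p)"
proof -
  \<comment> \<open>Conditioning makes sense only on a fibre of positive mass. On a fibre missed by
    \<open>p\<close> any of its points serves as the row, since \<open>p\<close> puts no weight
    there while \<open>q\<close> may.\<close>
  define K where "K t = (if t \<in> g ` set_pmf p then cond_pmf p {x. t = g x}
    else return_pmf (SOME x. x \<in> S \<and> g x = t))" for t
  have K: "set_pmf (K t) \<subseteq> S \<inter> g -` {t}" if t: "t \<in> g ` S" for t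
  proof (cases "t \<in> g ` set_pmf p")
    case True
    then have "set_pmf p \<inter> {x. t = g x} \<noteq> {}" by auto
    then show ?thesis using p True by (auto simp: K_def set_cond_pmf)
  next
    case False
    have "\<exists>x. x \<in> S \<and> g x = t" using t by auto
    from someI_ex[OF this] show ?thesis using False by (simp add: K_def)
  qed
  have "bind_pmf (map_pmf g p) K = bind_pmf p (\<lambda>x. K (g x))"
    by (simp add: bind_map_pmf)
  also have "\<dots> = bind_pmf p (\<lambda>x. cond_pmf p {y. g x = g y})"
    by (intro bind_pmf_cong) (auto simp: K_def)
  \<comment> \<open>Disintegration along the fibres of \<open>g\<close>: drawing a point from
    \<open>p\<close> and resampling within its fibre leaves \<open>p\<close> unchanged.\<close>
  also have "\<dots> = p"
    by (intro bind_cond_pmf_cancel) (auto simp: eq_commute)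
  finally have pK: "bind_pmf (map_pmf g p) K = p" .
  have "map_pmf g (bind_pmf q K) = bind_pmf q (\<lambda>t. map_pmf g (K t))"
    by (simp add: map_bind_pmf)
  also have "\<dots> = bind_pmf q return_pmf"
  proof (intro bind_pmf_cong refl)
    fix t assume "t \<in> set_pmf q"
    then have "set_pmf (K t) \<subseteq> g -` {t}" using K q by blast
    then have "map_pmf g (K t) = map_pmf (\<lambda>_. t) (K t)" by (intro map_pmf_cong) auto
    then show "map_pmf g (K t) = return_pmf t" by simp
  qed
  finally have "map_pmf g (bind_pmf q K) = q" by (simp add: bind_return_pmf')
  moreover have "set_pmf (bind_pmf q K) \<subseteq> S" unfolding set_bind_pmf using K q by blast
  moreover have "l1_dist S (bind_pmf q K) (bind_pmf (map_pmf g p) K)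
      \<le> l1_dist (g ` S) q (map_pmf g p)"
    using fin p q K by (intro l1_dist_bind_le) auto
  ultimately show ?thesis using that pK by metis
qed

text \<open>L1-balls are convex.\<close>

lemma l1_dist_average_le:
  assumes A: "finite A" "A \<noteq> {}" and f: "\<And>u. u \<in> A \<Longrightarrow> l1_dist S (f u) p \<le> \<epsilon>"
  shows "l1_dist S (average_pmf A f) p \<le> \<epsilon>"
proof -
  have c: "real (card A) > 0" using A by (simp add: card_gt_0_iff)
  have "pmf (average_pmf A f) x - pmf p x = (\<Sum>u\<in>A. pmf (f u) x - pmf p x) / real (card A)" for x
    using c by (simp add: pmf_average[OF A] sum_subtractf field_simps)
  then have "l1_dist S (average_pmf A f) p = (\<Sum>x\<in>S. \<bar>\<Sum>u\<in>A. pmf (f u) x - pmf p x\<bar>) / card A"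
    by (simp add: l1_dist_def sum_divide_distrib[where A=S])
  also have "\<dots> \<le> (\<Sum>x\<in>S. \<Sum>u\<in>A. \<bar>pmf (f u) x - pmf p x\<bar>) / card A"
    by (intro divide_right_mono sum_mono sum_abs) simp
  also have "\<dots> = (\<Sum>u\<in>A. l1_dist S (f u) p) / card A"
    unfolding l1_dist_def by (subst sum.swap) simp
  also have "\<dots> \<le> (\<Sum>u\<in>A. \<epsilon>) / card A"
    by (intro divide_right_mono sum_mono f) auto
  also have "\<dots> = \<epsilon>" using c by simp
  finally show ?thesis .
qed

text \<open>As \<open>s\<close> and \<open>t\<close> differ, both weights are one half and the
  average is the midpoint. Convexity alone would give the full distance; the half later cancels the
  factor 2 in the bound by \<open>d_local\<close>.\<close>

lemma l1_dist_average_pair: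
  assumes "s \<noteq> t"
  shows "l1_dist S (average_pmf {s, t} f) (f s) = l1_dist S (f s) (f t) / 2"
    and "l1_dist S (average_pmf {s, t} f) (f t) = l1_dist S (f s) (f t) / 2"
proof -
  have *: "pmf (average_pmf {s, t} f) x = (pmf (f s) x + pmf (f t) x) / 2" for x
    using assms by (simp add: pmf_average)
  have "\<bar>(a + b) / 2 - a\<bar> = \<bar>a - b\<bar> / 2" "\<bar>(a + b) / 2 - b\<bar> = \<bar>a - b\<bar> / 2" for a b :: real
    by (auto simp: abs_if field_simps)
  then show "l1_dist S (average_pmf {s, t} f) (f s) = l1_dist S (f s) (f t) / 2"
    "l1_dist S (average_pmf {s, t} f) (f t) = l1_dist S (f s) (f t) / 2"
    by (simp_all add: l1_dist_def * sum_divide_distrib)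
qed

section \<open>Functional bisimulations\<close>

text \<open>A surjective, label-preserving coalgebra morphism: \<open>lmc_iso\<close> without
  injectivity. The class map of a quotient is the main example.\<close>

definition lmc_hom :: "('s \<Rightarrow> 't) \<Rightarrow> ('s, 'l) lmc \<Rightarrow> ('t, 'l) lmc \<Rightarrow> bool" where
  "lmc_hom g M N \<longleftrightarrow> labels N = labels M \<and> g ` states M = states N \<and>
     (\<forall>s\<in>states M. tau N (g s) = map_pmf g (tau M s) \<and> lbl N (g s) = lbl M s)"

definition bisim_minimal :: "('s, 'l) lmc \<Rightarrow> bool" where
  "bisim_minimal M \<longleftrightarrow> (\<forall>R. prob_bisim M R \<longrightarrow> R \<subseteq> Id)"

lemma lmc_hom_comp:
  assumes "lmc_hom g M N" "lmc_hom h N P"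
  shows "lmc_hom (h \<circ> g) M P"
proof -
  have "g s \<in> states N" if "s \<in> states M" for s using assms that by (auto simp: lmc_hom_def)
  moreover have "(h \<circ> g) ` states M = h ` g ` states M" by (rule image_comp[symmetric])
  ultimately show ?thesis using assms by (simp add: lmc_hom_def pmf.map_comp)
qed

lemma lmc_iso_imp_hom:
  assumes "lmc_iso M N"
  obtains f where "lmc_hom f M N"
  using assms by (auto simp: lmc_iso_def lmc_hom_def bij_betw_def)

lemma is_lmc_set_tau: "is_lmc M \<Longrightarrow> s \<in> states M \<Longrightarrow> set_pmf (tau M s) \<subseteq> states M"
  by (auto simp: is_lmc_def transition_function_def)

lemma is_lmc_hom:
  assumes "lmc_hom g M N" "is_lmc M"
  shows "is_lmc N"
proof -
  have "states N = g ` states M" using assms by (simp add: lmc_hom_def)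
  moreover have "set_pmf (tau N (g s)) \<subseteq> g ` states M" if "s \<in> states M" for s
    using assms is_lmc_set_tau[OF assms(2) that] that by (auto simp: lmc_hom_def)
  ultimately show ?thesis
    using assms by (auto simp: lmc_hom_def is_lmc_def transition_function_def)
qed

text \<open>A class of the pulled-back relation is, within \<open>states M\<close>, the preimage of
  a class of \<open>R\<close>. Since \<open>tau N (g s)\<close> is the push-forward of
  \<open>tau M s\<close>, both classes carry the same mass.\<close>

lemma prob_bisim_vimage:
  assumes M: "is_lmc M" and g: "lmc_hom g M N" and R: "prob_bisim N R"
  shows "prob_bisim M {(s, t) \<in> states M \<times> states M. (g s, g t) \<in> R}" (is "prob_bisim M ?R")
proof -
  have eq: "equiv (states N) R" using R by (simp add: prob_bisim_def)
  have gs: "g s \<in> states N" if "s \<in> states M" for s using g that by (auto simp: lmc_hom_def)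
  have eq': "equiv (states M) ?R"
  proof (rule equivI)
    show "refl_on (states M) ?R"
      using gs equiv_class_self[OF eq] by (auto simp: refl_on_def)
    show "sym ?R" using eq by (auto simp: equiv_def sym_def)
    show "trans ?R" using eq unfolding equiv_def trans_def by blast
  qed auto
  have "measure_pmf.prob (tau M s) E = measure_pmf.prob (tau M t) E"
    if st: "(s, t) \<in> ?R" and E: "E \<in> states M // ?R" for s t E
  proof -
    from E obtain x where x: "x \<in> states M" "E = ?R `` {x}" by (auto simp: quotient_def)
    define F where "F = R `` {g x}"
    have F: "F \<in> states N // R" unfolding F_def using gs[OF x(1)] by (rule quotientI)
    have *: "measure_pmf.prob (tau M u) E = measure_pmf.prob (tau N (g u)) F"
      if u: "u \<in> states M" for u
    proof -
      have "measure_pmf.prob (tau M u) E = measure_pmf.prob (tau M u) (g -` F)"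
        using is_lmc_set_tau[OF M u] x
        by (intro measure_prob_cong_0) (auto simp: F_def pmf_eq_0_set_pmf)
      then show ?thesis using g u by (simp add: lmc_hom_def)
    qed
    show ?thesis using st F R by (auto simp: * prob_bisim_def)
  qed
  moreover have "lbl M s = lbl M t" if "(s, t) \<in> ?R" for s t
    using that g R by (fastforce simp: lmc_hom_def prob_bisim_def)
  ultimately show ?thesis using eq' unfolding prob_bisim_def by blast
qed

section \<open>Minimal chains and uniqueness of the bisimulation quotient\<close>

lemma bisim_minimal_hom:
  assumes "is_lmc M" "bisim_minimal M" "lmc_hom g M N"
  shows "bisim_minimal N"
  unfolding bisim_minimal_def
proof (intro allI impI subrelI)
  fix R a b assume R: "prob_bisim N R" and ab: "(a, b) \<in> R"
  then have "a \<in> states N" "b \<in> states N" by (auto simp: prob_bisim_def equiv_def)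
  then obtain s t where "s \<in> states M" "t \<in> states M" "a = g s" "b = g t"
    using assms(3) unfolding lmc_hom_def by blast
  then show "(a, b) \<in> Id"
    using assms(2) prob_bisim_vimage[OF assms(1,3) R] ab by (auto simp: bisim_minimal_def)
qed

lemma lmc_hom_quotient:
  assumes M: "is_lmc M" and R: "prob_bisim M R"
  shows "lmc_hom (\<lambda>s. R `` {s}) M (quotient_lmc M R)"
proof -
  have eq: "equiv (states M) R" using R by (simp add: prob_bisim_def)
  have "tau (quotient_lmc M R) (R `` {s}) = map_pmf (\<lambda>s. R `` {s}) (tau M s)"
    if s: "s \<in> states M" for s
  proof (rule pmf_eqI)
    fix E
    define s' where "s' = (SOME x. x \<in> R `` {s})"
    have "s' \<in> states M"
      unfolding s'_def using some_in_class[OF eq s] eq by (auto simp: equiv_def)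
    then have *: "set_pmf (tau (quotient_lmc M R) (R `` {s})) \<subseteq> (\<lambda>x. R `` {x}) ` states M"
      using is_lmc_set_tau[OF M] by (auto simp: quotient_lmc_def s'_def)
    show "pmf (tau (quotient_lmc M R) (R `` {s})) E = pmf (map_pmf (\<lambda>s. R `` {s}) (tau M s)) E"
    proof (cases "E \<in> (\<lambda>x. R `` {x}) ` states M")
      case True
      then show ?thesis
        using quotient_lmc_tau[OF M R s] prob_class_eq_pmf[OF eq is_lmc_set_tau[OF M s]] by auto
    next
      \<comment> \<open>Class probabilities determine the values at classes only; any other set lies
        outside both supports.\<close>
      case False
      then have "E \<notin> set_pmf (tau (quotient_lmc M R) (R `` {s}))"
        "E \<notin> set_pmf (map_pmf (\<lambda>s. R `` {s}) (tau M s))"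
        using * is_lmc_set_tau[OF M s] by auto
      then show ?thesis by (metis pmf_eq_0_set_pmf)
    qed
  qed
  then show ?thesis
    using quotient_lmc_lbl[OF R] by (auto simp: lmc_hom_def quotient_def quotient_lmc_def)
qed

lemma prob_bisim_bisimilarity: "is_lmc M \<Longrightarrow> prob_bisim M (bisimilarity M)"
  by (simp add: bisimilarity_largest is_lmc_def)

text \<open>A bisimulation of the quotient pulls back to one of \<open>M\<close>, hence into
  \<open>bisimilarity M\<close>, so classes that it relates have bisimilar representatives and
  coincide.\<close>

lemma bisim_minimal_quotient:
  assumes M: "is_lmc M"
  shows "bisim_minimal (bisim_quotient M)"
  unfolding bisim_minimal_def
proof (intro allI impI subrelI)
  let ?B = "bisimilarity M"
  have B: "prob_bisim M ?B" using M by (rule prob_bisim_bisimilarity)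
  then have eq: "equiv (states M) ?B" by (simp add: prob_bisim_def)
  fix R a b assume R: "prob_bisim (bisim_quotient M) R" and ab: "(a, b) \<in> R"
  then have "a \<in> states M // ?B" "b \<in> states M // ?B"
    by (auto simp: prob_bisim_def equiv_def quotient_lmc_def)
  then obtain s t where st: "s \<in> states M" "t \<in> states M" "a = ?B `` {s}" "b = ?B `` {t}"
    by (auto simp: quotient_def)
  have "finite (states M)" using M by (simp add: is_lmc_def)
  from bisimilarity_largest(2)[OF this prob_bisim_vimage[OF M lmc_hom_quotient[OF M B] R]]
  have "(s, t) \<in> ?B" using st ab by auto
  then show "(a, b) \<in> Id" using st equiv_class_eq[OF eq] by simp
qed

text \<open>The kernel is the pull-back of the identity and thus a bisimulation. Conversely the
  image of bisimilarity under \<open>g\<close> is a bisimulation of \<open>N\<close>, which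
  minimality collapses to the identity.\<close>

lemma bisimilarity_eq_kernel:
  assumes M: "is_lmc M" and g: "lmc_hom g M N" and min: "bisim_minimal N"
  shows "bisimilarity M = {(s, t) \<in> states M \<times> states M. g s = g t}"
proof
  let ?B = "bisimilarity M"
  define R where "R = {(g s, g t) | s t. (s, t) \<in> ?B}"
  have fin: "finite (states M)" using M by (simp add: is_lmc_def)
  have B: "prob_bisim M ?B" using M by (rule prob_bisim_bisimilarity)
  then have eq: "equiv (states M) ?B" by (simp add: prob_bisim_def)
  have N: "states N = g ` states M" using g by (simp add: lmc_hom_def)
  have "{(s, t) \<in> states M \<times> states M. (g s, g t) \<in> Id_on (states N)} \<subseteq> ?B" (is "?K \<subseteq> _")
    by (rule bisimilarity_largest(2)[OF fin prob_bisim_vimage[OF M g prob_bisim_Id]])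
  moreover have "{(s, t) \<in> states M \<times> states M. g s = g t} \<subseteq> ?K" by (auto simp: N Id_on_iff)
  ultimately show ker: "{(s, t) \<in> states M \<times> states M. g s = g t} \<subseteq> ?B" by (rule order.trans[rotated])
  have BS: "?B \<subseteq> states M \<times> states M" using eq by (simp add: equiv_def)
  \<comment> \<open>As \<open>?B\<close> contains the kernel of \<open>g\<close>, membership does
    not depend on the choice of preimages. This is what makes the image relation \<open>R\<close>
    transitive.\<close>
  have RB: "(g s, g t) \<in> R \<longleftrightarrow> (s, t) \<in> ?B" if st: "s \<in> states M" "t \<in> states M" for s t
  proof
    assume "(g s, g t) \<in> R"
    then obtain s' t' where *: "(s', t') \<in> ?B" "g s = g s'" "g t = g t'" by (auto simp: R_def)
    then have "(s, s') \<in> ?B" "(t', t) \<in> ?B" using ker BS st by auto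
    then show "(s, t) \<in> ?B" using *(1) eq unfolding equiv_def by (metis transD)
  qed (auto simp: R_def)
  have RS: "R \<subseteq> states N \<times> states N" using BS N by (auto simp: R_def)
  have eqR: "equiv (states N) R"
  proof (rule equivI)
    show "R \<subseteq> states N \<times> states N" by (rule RS)
    show "refl_on (states N) R"
      using equiv_class_self[OF eq] N unfolding refl_on_def R_def by blast
    show "sym R" using eq unfolding equiv_def sym_def R_def by blast
    show "trans R"
    proof (rule transI)
      fix a b c assume ab: "(a, b) \<in> R" and bc: "(b, c) \<in> R"
      have "a \<in> g ` states M" "b \<in> g ` states M" "c \<in> g ` states M"
        using ab bc RS N by auto
      then obtain s t u where stu: "s \<in> states M" "t \<in> states M" "u \<in> states M"
        and abc: "a = g s" "b = g t" "c = g u" by (elim imageE)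
      have "(s, t) \<in> ?B" "(t, u) \<in> ?B" using ab bc RB stu unfolding abc by blast+
      then have "(s, u) \<in> ?B" using eq unfolding equiv_def by (metis transD)
      then show "(a, c) \<in> R" using RB stu unfolding abc by blast
    qed
  qed
  have "prob_bisim N R"
    unfolding prob_bisim_def
  proof (intro conjI eqR ballI, clarify, intro conjI ballI)
    fix a b assume "(a, b) \<in> R"
    then obtain s t where st: "(s, t) \<in> ?B" "a = g s" "b = g t" by (auto simp: R_def)
    then have s: "s \<in> states M" and t: "t \<in> states M" using BS by auto
    show "lbl N a = lbl N b" using st s t B g by (auto simp: lmc_hom_def prob_bisim_def)
    fix F assume "F \<in> states N // R"
    then obtain x where x: "x \<in> states M" "F = R `` {g x}" using N by (auto simp: quotient_def)
    have "measure_pmf.prob (tau N (g u)) F = measure_pmf.prob (tau M u) (?B `` {x})"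
      if u: "u \<in> states M" for u
    proof -
      have "measure_pmf.prob (tau N (g u)) F = measure_pmf.prob (tau M u) (g -` F)"
        using g u by (simp add: lmc_hom_def)
      also have "\<dots> = measure_pmf.prob (tau M u) (?B `` {x})"
      proof (rule measure_prob_cong_0)
        fix y assume "y \<in> g -` F - ?B `` {x}"
        then have "y \<notin> states M" using RB x by auto
        then show "pmf (tau M u) y = 0"
          using is_lmc_set_tau[OF M u] by (auto simp: pmf_eq_0_set_pmf)
      next
        fix y assume "y \<in> ?B `` {x} - g -` F"
        then show "pmf (tau M u) y = 0" using x by (auto simp: R_def)
      qed
      finally show ?thesis .
    qed
    then show "measure_pmf.prob (tau N a) F = measure_pmf.prob (tau N b) F"
      using st s t B quotientI[OF x(1), of ?B] by (auto simp: prob_bisim_def)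
  qed
  then have "R \<subseteq> Id" using min by (simp add: bisim_minimal_def)
  then show "?B \<subseteq> {(s, t) \<in> states M \<times> states M. g s = g t}"
    using BS by (auto simp: R_def)
qed

text \<open>Bisimilarity is exactly the kernel of \<open>g\<close>, so \<open>g\<close> factors
  through the class map by an injection \<open>f\<close>.\<close>

lemma lmc_iso_bisim_quotient:
  assumes M: "is_lmc M" and g: "lmc_hom g M N" and min: "bisim_minimal N"
  shows "lmc_iso (bisim_quotient M) N"
proof -
  let ?B = "bisimilarity M"
  define c where "c = (\<lambda>s. ?B `` {s})"
  define f where "f E = g (SOME s. s \<in> E)" for E
  have B: "prob_bisim M ?B" using M by (rule prob_bisim_bisimilarity)
  then have eq: "equiv (states M) ?B" by (simp add: prob_bisim_def)
  have c: "lmc_hom c M (bisim_quotient M)" unfolding c_def by (rule lmc_hom_quotient[OF M B])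
  \<comment> \<open>\<open>SOME\<close> may return another member of the class, but \<open>g\<close>
    is constant on classes.\<close>
  have fc: "f (c s) = g s" if "s \<in> states M" for s
  proof -
    have "(s, SOME x. x \<in> c s) \<in> ?B" unfolding c_def by (rule some_in_class[OF eq that])
    then show ?thesis unfolding bisimilarity_eq_kernel[OF M g min] f_def by simp
  qed
  have S: "states (bisim_quotient M) = c ` states M" using c by (simp add: lmc_hom_def)
  have "inj_on f (c ` states M)"
  proof (rule inj_onI)
    fix E F assume "E \<in> c ` states M" "F \<in> c ` states M" "f E = f F"
    then obtain s t where "s \<in> states M" "t \<in> states M" "E = c s" "F = c t" "g s = g t"
      using fc by auto
    then show "E = F" by (auto simp: c_def bisimilarity_eq_kernel[OF M g min])
  qed
  moreover have "f ` c ` states M = states N"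
    using g fc by (simp add: lmc_hom_def image_image)
  moreover have "tau N (f (c s)) = map_pmf f (tau (bisim_quotient M) (c s)) \<and>
      lbl N (f (c s)) = lbl (bisim_quotient M) (c s)" if s: "s \<in> states M" for s
  proof -
    have "map_pmf f (tau (bisim_quotient M) (c s)) = map_pmf (\<lambda>x. f (c x)) (tau M s)"
      using c s by (simp add: lmc_hom_def map_pmf_comp)
    also have "\<dots> = map_pmf g (tau M s)"
      using is_lmc_set_tau[OF M s] fc by (intro map_pmf_cong) auto
    finally show ?thesis using g c s fc by (simp add: lmc_hom_def)
  qed
  moreover have "labels N = labels (bisim_quotient M)" using g c by (simp add: lmc_hom_def)
  ultimately show ?thesis by (auto simp: lmc_iso_def S bij_betw_def intro!: exI[of _ f])
qed

lemma bisim_quotient_iso_hom: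
  assumes M: "is_lmc M" and iso: "lmc_iso (bisim_quotient M) N"
  obtains g where "lmc_hom g M N" "bisim_minimal N" "is_lmc N"
proof -
  obtain f where f: "lmc_hom f (bisim_quotient M) N" using lmc_iso_imp_hom[OF iso] .
  have q: "lmc_hom (\<lambda>s. bisimilarity M `` {s}) M (bisim_quotient M)"
    by (rule lmc_hom_quotient[OF M prob_bisim_bisimilarity[OF M]])
  have Q: "is_lmc (bisim_quotient M)" by (rule is_lmc_hom[OF q M])
  show ?thesis
    using that[OF lmc_hom_comp[OF q f] bisim_minimal_hom[OF Q bisim_minimal_quotient[OF M] f]
        is_lmc_hom[OF f Q]] .
qed

section \<open>Composition of approximate quotients\<close>

lemma is_lmc_update_tau:
  "is_lmc M \<Longrightarrow> transition_function (states M) \<tau> \<Longrightarrow> is_lmc (M\<lparr>tau := \<tau>\<rparr>)"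
  by (simp add: is_lmc_def)

text \<open>Together with \<open>eps_quotientE\<close> this trades the isomorphism with a
  bisimulation quotient for a homomorphism onto a minimal chain, a form that composes.\<close>

lemma eps_quotientI:
  assumes M: "is_lmc M" and "0 \<le> \<epsilon>" and \<tau>: "transition_function (states M) \<tau>"
    and "\<And>s. s \<in> states M \<Longrightarrow> l1_dist (states M) (\<tau> s) (tau M s) \<le> \<epsilon>"
    and g: "lmc_hom g (M\<lparr>tau := \<tau>\<rparr>) Q" and min: "bisim_minimal Q"
  shows "eps_quotient \<epsilon> Q M"
proof -
  have N: "is_lmc (M\<lparr>tau := \<tau>\<rparr>)" using M \<tau> by (rule is_lmc_update_tau)
  show ?thesis
    using assms is_lmc_hom[OF g N] lmc_iso_bisim_quotient[OF N g min]
    unfolding eps_quotient_def by blast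
qed

lemma eps_quotientE:
  assumes M: "is_lmc M" and Q: "eps_quotient \<epsilon> Q M"
  obtains \<tau> g where "0 \<le> \<epsilon>" "transition_function (states M) \<tau>"
    "\<And>s. s \<in> states M \<Longrightarrow> l1_dist (states M) (\<tau> s) (tau M s) \<le> \<epsilon>"
    "lmc_hom g (M\<lparr>tau := \<tau>\<rparr>) Q" "bisim_minimal Q" "is_lmc Q"
proof -
  from Q obtain \<tau> where *: "0 \<le> \<epsilon>" "transition_function (states M) \<tau>"
    "\<And>s. s \<in> states M \<Longrightarrow> l1_dist (states M) (\<tau> s) (tau M s) \<le> \<epsilon>"
    "lmc_iso (bisim_quotient (M\<lparr>tau := \<tau>\<rparr>)) Q"
    unfolding eps_quotient_def by blast
  obtain g where "lmc_hom g (M\<lparr>tau := \<tau>\<rparr>) Q" "bisim_minimal Q" "is_lmc Q"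
    by (rule bisim_quotient_iso_hom[OF is_lmc_update_tau[OF M *(2)] *(4)])
  with * that show ?thesis by blast
qed

text \<open>\<open>l1_dist_lift\<close> is applied at every state. The prescribed row
  \<open>\<tau> (g s)\<close> depends only on \<open>g s\<close>, so \<open>g\<close> can become a
  homomorphism from the lifted chain.\<close>

lemma lift_transition_function:
  assumes M: "is_lmc M" and \<tau>: "transition_function (g ` states M) \<tau>"
    and d: "\<And>s. s \<in> states M \<Longrightarrow> l1_dist (g ` states M) (\<tau> (g s)) (map_pmf g (tau M s)) \<le> \<epsilon>"
  obtains \<tau>' where "transition_function (states M) \<tau>'"
    "\<And>s. s \<in> states M \<Longrightarrow> l1_dist (states M) (\<tau>' s) (tau M s) \<le> \<epsilon>"
    "\<And>s. s \<in> states M \<Longrightarrow> map_pmf g (\<tau>' s) = \<tau> (g s)"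
proof -
  have "\<exists>p. set_pmf p \<subseteq> states M \<and> l1_dist (states M) p (tau M s) \<le> \<epsilon> \<and> map_pmf g p = \<tau> (g s)"
    if s: "s \<in> states M" for s
  proof (rule l1_dist_lift)
    show "finite (states M)" using M by (simp add: is_lmc_def)
    show "set_pmf (tau M s) \<subseteq> states M" using M s by (rule is_lmc_set_tau)
    show "set_pmf (\<tau> (g s)) \<subseteq> g ` states M" using \<tau> s by (auto simp: transition_function_def)
  qed (use d[OF s] in \<open>force intro: order.trans\<close>)
  then obtain \<tau>' where "\<forall>s\<in>states M. set_pmf (\<tau>' s) \<subseteq> states M \<and>
      l1_dist (states M) (\<tau>' s) (tau M s) \<le> \<epsilon> \<and> map_pmf g (\<tau>' s) = \<tau> (g s)"
    by metis
  then show ?thesis by (intro that[of \<tau>']) (simp_all add: transition_function_def)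
qed

lemma eps_quotient_trans:
  assumes M: "is_lmc M" and Q: "eps_quotient \<epsilon> Q M" and P: "eps_quotient \<delta> P Q"
  shows "eps_quotient (\<epsilon> + \<delta>) P M"
proof -
  obtain \<tau> g where 1: "0 \<le> \<epsilon>" "transition_function (states M) \<tau>"
      "\<And>s. s \<in> states M \<Longrightarrow> l1_dist (states M) (\<tau> s) (tau M s) \<le> \<epsilon>"
      "lmc_hom g (M\<lparr>tau := \<tau>\<rparr>) Q" and Q': "is_lmc Q"
    by (rule eps_quotientE[OF M Q]) blast
  obtain \<tau>' h where 2: "0 \<le> \<delta>" "transition_function (states Q) \<tau>'"
      "\<And>s. s \<in> states Q \<Longrightarrow> l1_dist (states Q) (\<tau>' s) (tau Q s) \<le> \<delta>"
      "lmc_hom h (Q\<lparr>tau := \<tau>'\<rparr>) P" "bisim_minimal P"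
    by (rule eps_quotientE[OF Q' P]) blast
  let ?M = "M\<lparr>tau := \<tau>\<rparr>"
  have M': "is_lmc ?M" using M 1(2) by (rule is_lmc_update_tau)
  have S: "g ` states ?M = states Q" using 1(4) by (simp add: lmc_hom_def)
  have \<tau>': "transition_function (g ` states ?M) \<tau>'" using 2(2) unfolding S .
  have d: "l1_dist (g ` states ?M) (\<tau>' (g s)) (map_pmf g (tau ?M s)) \<le> \<delta>"
    if "s \<in> states ?M" for s
    using that 1(4) 2(3)[of "g s"] unfolding S by (auto simp: lmc_hom_def)
  \<comment> \<open>The second perturbation is lifted to the already perturbed chain
    \<open>?M\<close>, because \<open>g\<close> is a homomorphism from \<open>?M\<close> and not
    necessarily from \<open>M\<close>.\<close>
  obtain \<sigma> where 3: "transition_function (states ?M) \<sigma>"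
    "\<And>s. s \<in> states ?M \<Longrightarrow> l1_dist (states ?M) (\<sigma> s) (tau ?M s) \<le> \<delta>"
    "\<And>s. s \<in> states ?M \<Longrightarrow> map_pmf g (\<sigma> s) = \<tau>' (g s)"
    using lift_transition_function[OF M' \<tau>' d] by (metis (no_types))
  show ?thesis
  proof (rule eps_quotientI[OF M, of _ \<sigma>])
    show "0 \<le> \<epsilon> + \<delta>" using 1(1) 2(1) by simp
    show "transition_function (states M) \<sigma>" using 3(1) by simp
    show "l1_dist (states M) (\<sigma> s) (tau M s) \<le> \<epsilon> + \<delta>" if "s \<in> states M" for s
      using 1(3)[OF that] 3(2)[of s] that l1_dist_triangle[of "states M" "\<sigma> s" "tau M s" "\<tau> s"]
      by simp
    have "lmc_hom g (M\<lparr>tau := \<sigma>\<rparr>) (Q\<lparr>tau := \<tau>'\<rparr>)"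
      using 1(4) 3(3) by (simp add: lmc_hom_def)
    then show "lmc_hom (h \<circ> g) (M\<lparr>tau := \<sigma>\<rparr>) P" using 2(4) by (rule lmc_hom_comp)
    show "bisim_minimal P" by (rule 2(5))
  qed
qed

lemma eps_quotient_0:
  assumes M: "is_lmc M" and iso: "lmc_iso (bisim_quotient M) Q"
  shows "eps_quotient 0 Q M"
proof -
  obtain g where "lmc_hom g M Q" "bisim_minimal Q"
    by (rule bisim_quotient_iso_hom[OF M iso])
  then show ?thesis
    using M by (intro eps_quotientI[OF M, of _ "tau M" g]) (auto simp: is_lmc_def)
qed

text \<open>Both merge operations are of this form, with \<open>g\<close> mapping a state to its block.\<close>

lemma eps_quotient_merge:
  assumes M: "is_lmc M" and "0 \<le> \<epsilon>" and labels: "labels N = labels M" and S: "g ` states M = states N"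
    and lbl: "\<And>s. s \<in> states M \<Longrightarrow> lbl N (g s) = lbl M s"
    and \<tau>: "transition_function (states N) (tau N)"
    and d: "\<And>s. s \<in> states M \<Longrightarrow> l1_dist (states N) (tau N (g s)) (map_pmf g (tau M s)) \<le> \<epsilon>"
    and iso: "lmc_iso (bisim_quotient N) Q"
  shows "eps_quotient \<epsilon> Q M"
proof -
  obtain \<sigma> where 1: "transition_function (states M) \<sigma>"
    "\<And>s. s \<in> states M \<Longrightarrow> l1_dist (states M) (\<sigma> s) (tau M s) \<le> \<epsilon>"
    "\<And>s. s \<in> states M \<Longrightarrow> map_pmf g (\<sigma> s) = tau N (g s)"
    by (rule lift_transition_function[OF M, of g "tau N" \<epsilon>]) (use S \<tau> d in auto)
  have g: "lmc_hom g (M\<lparr>tau := \<sigma>\<rparr>) N" using labels S lbl 1(3) by (simp add: lmc_hom_def)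
  have N: "is_lmc N" by (rule is_lmc_hom[OF g is_lmc_update_tau[OF M 1(1)]])
  obtain h where h: "lmc_hom h N Q" "bisim_minimal Q"
    by (rule bisim_quotient_iso_hom[OF N iso])
  show ?thesis
    using eps_quotientI[OF M \<open>0 \<le> \<epsilon>\<close> 1(1,2) lmc_hom_comp[OF g h(1)] h(2)] .
qed

section \<open>Merging the blocks of a partition\<close>

text \<open>Names the map inside \<open>lump\<close>, so that lumping is a push-forward along a map
  on states and can be lifted back.\<close>

definition block_of :: "'s set set \<Rightarrow> 's \<Rightarrow> 's set" where
  "block_of X x = (THE E. E \<in> X \<and> x \<in> E)"

lemma lump_eq_map_pmf: "lump X p = map_pmf (block_of X) p"
  by (simp add: lump_def block_of_def[abs_def])

lemma block_of_eq:
  assumes "partition_on S X" "E \<in> X" "x \<in> E"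
  shows "block_of X x = E"
  unfolding block_of_def
  using assms by (intro the_equality) (auto simp: partition_on_def disjoint_def)

lemma block_of_mem:
  assumes X: "partition_on S X" and "x \<in> S"
  shows "block_of X x \<in> X" "x \<in> block_of X x"
proof -
  obtain E where "E \<in> X" "x \<in> E" using assms by (auto simp: partition_on_def)
  with block_of_eq[OF X] show "block_of X x \<in> X" "x \<in> block_of X x" by auto
qed

lemma block_of_image:
  assumes X: "partition_on S X"
  shows "block_of X ` S = X"
proof
  show "X \<subseteq> block_of X ` S"
  proof
    fix E assume E: "E \<in> X"
    then have "E \<noteq> {}" "E \<subseteq> S" using X by (auto simp: partition_on_def)
    then obtain x where "x \<in> E" "x \<in> S" by blast
    then show "E \<in> block_of X ` S" using block_of_eq[OF X E] by blast
  qed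
qed (use block_of_mem[OF X] in auto)

lemma set_lump:
  assumes X: "partition_on S X" and "set_pmf p \<subseteq> S"
  shows "set_pmf (lump X p) \<subseteq> X"
  using assms block_of_mem(1)[OF X] by (auto simp: lump_eq_map_pmf)

lemma block_dist_eq_l1_dist:
  assumes X: "partition_on S X" and p: "set_pmf p \<subseteq> S" "set_pmf q \<subseteq> S"
  shows "block_dist X p q = l1_dist X (lump X p) (lump X q)"
  unfolding block_dist_def l1_dist_def
  using pmf_lump[OF X p(1)] pmf_lump[OF X p(2)] by (intro sum.cong) auto

lemma set_average:
  assumes "finite A" "A \<noteq> {}"
  shows "set_pmf (average_pmf A f) = (\<Union>u\<in>A. set_pmf (f u))"
  using assms by (simp add: average_pmf_def)

section \<open>Approximate partition refinement\<close>

definition similar_states :: "('s, 'l) lmc \<Rightarrow> real \<Rightarrow> 's set set \<Rightarrow> 's \<Rightarrow> 's \<Rightarrow> bool" where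
  "similar_states M \<epsilon> Y s t \<longleftrightarrow> lbl M s = lbl M t \<and> block_dist Y (tau M s) (tau M t) \<le> \<epsilon>"

text \<open>All pairs are required because similarity is not transitive in general. The blocks
  compared (\<open>X\<close>) and the partition measuring them (\<open>Y\<close>) are separate,
  since a refinement round measures new blocks against the old partition.\<close>

definition similar_blocks :: "('s, 'l) lmc \<Rightarrow> real \<Rightarrow> 's set set \<Rightarrow> 's set set \<Rightarrow> bool" where
  "similar_blocks M \<epsilon> Y X \<longleftrightarrow> (\<forall>E\<in>X. \<forall>s\<in>E. \<forall>t\<in>E. similar_states M \<epsilon> Y s t)"

lemma similar_states_refl: "0 \<le> \<epsilon> \<Longrightarrow> similar_states M \<epsilon> Y s s"
  by (simp add: similar_states_def block_dist_def)

lemma similar_states_sym: "similar_states M \<epsilon> Y s t \<Longrightarrow> similar_states M \<epsilon> Y t s"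
  by (auto simp: similar_states_def block_dist_def abs_minus_commute)

text \<open>A state joins a block only after comparison with every member, so pairwise similarity
  survives whichever compatible block the averages select.\<close>

lemma apr_insert_partition:
  assumes ins: "apr_insert M \<epsilon> Y s X X'" and \<epsilon>: "0 \<le> \<epsilon>" and s: "s \<notin> A"
    and X: "partition_on A X" and sim: "similar_blocks M \<epsilon> Y X"
  shows "partition_on (insert s A) X'" "similar_blocks M \<epsilon> Y X'"
proof -
  have "partition_on (insert s A) X' \<and> similar_blocks M \<epsilon> Y X'"
  proof (cases "apr_compatible M \<epsilon> Y s X = {}")
    case True
    then have X': "X' = insert {s} X" using ins by (simp add: apr_insert_def)
    show ?thesis
      unfolding X' using X sim s \<epsilon>
      by (auto simp: partition_on_def disjoint_def similar_blocks_def similar_states_refl)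
  next
    case False
    then obtain E where E: "E \<in> apr_compatible M \<epsilon> Y s X"
      and X': "X' = insert (E \<union> {s}) (X - {E})"
      using ins by (auto simp: apr_insert_def Let_def)
    have EX: "E \<in> X" and 1: "\<forall>t\<in>E. similar_states M \<epsilon> Y s t"
      using E by (auto simp: apr_compatible_def similar_states_def)
    then have 2: "\<forall>t\<in>E. similar_states M \<epsilon> Y t s" by (auto intro: similar_states_sym)
    have "similar_blocks M \<epsilon> Y X'"
      unfolding X' using sim EX 1 2 similar_states_refl[OF \<epsilon>, of M Y s]
      by (auto simp: similar_blocks_def)
    moreover have "partition_on (insert s A) X'"
    proof (rule partition_onI)
      show "\<Union>X' = insert s A" unfolding X' using EX X by (auto simp: partition_on_def)
      show "disjnt p q" if "p \<in> X'" "q \<in> X'" "p \<noteq> q" for p q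
      proof -
        have "D \<inter> (E \<union> {s}) = {}" if "D \<in> X - {E}" for D
          using that EX X s by (auto simp: partition_on_def disjoint_def)
        moreover have "D \<inter> F = {}" if "D \<in> X" "F \<in> X" "D \<noteq> F" for D F
          using that X by (simp add: partition_on_def disjoint_def)
        ultimately show ?thesis using that unfolding X' disjnt_def by (metis DiffD1 Int_commute insertE)
      qed
      show "{} \<notin> X'" unfolding X' using X by (auto simp: partition_on_def)
    qed
    ultimately show ?thesis by simp
  qed
  then show "partition_on (insert s A) X'" "similar_blocks M \<epsilon> Y X'" by auto
qed

text \<open>\<open>A\<close> stands for the states processed so far and grows during the induction;
  a split starts with \<open>A\<close> empty.\<close>

lemma apr_process_partition:
  assumes "apr_process M \<epsilon> Y ss X X'" "0 \<le> \<epsilon>" "distinct ss" "set ss \<inter> A = {}"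
    and "partition_on A X" "similar_blocks M \<epsilon> Y X"
  shows "partition_on (set ss \<union> A) X' \<and> similar_blocks M \<epsilon> Y X'"
  using assms
proof (induction arbitrary: A rule: apr_process.induct)
  case (insert s X X' ss X'')
  have "s \<notin> A" using insert.prems by simp
  note ins = apr_insert_partition[OF insert.hyps(1) \<open>0 \<le> \<epsilon>\<close> this insert.prems(4,5)]
  show ?case using insert.IH[OF _ _ _ ins] insert.prems by simp
qed simp

lemma apr_refine_partition:
  assumes ref: "apr_refine M \<epsilon> Y Y'" and \<epsilon>: "0 \<le> \<epsilon>" and Y: "partition_on S Y"
  shows "partition_on S Y'" "similar_blocks M \<epsilon> Y Y'"
proof -
  obtain X where X: "\<And>E. E \<in> Y \<Longrightarrow> apr_split M \<epsilon> Y E (X E)" and Y': "Y' = (\<Union>E\<in>Y. X E)"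
    using ref by (auto simp: apr_refine_def)
  have *: "partition_on E (X E) \<and> similar_blocks M \<epsilon> Y (X E)" if E: "E \<in> Y" for E
  proof -
    obtain ss where "distinct ss" "set ss = E" "apr_process M \<epsilon> Y ss {} (X E)"
      using X[OF E] by (auto simp: apr_split_def)
    then show ?thesis
      using apr_process_partition[of M \<epsilon> Y ss "{}" "X E" "{}"] \<epsilon>
      by (simp add: partition_on_empty similar_blocks_def)
  qed
  then show "similar_blocks M \<epsilon> Y Y'" by (auto simp: Y' similar_blocks_def)
  have U: "\<Union>(X E) = E" if "E \<in> Y" for E using *[OF that] by (simp add: partition_on_def)
  show "partition_on S Y'"
  proof (rule partition_onI)
    have "\<Union>Y' = (\<Union>E\<in>Y. \<Union>(X E))" by (auto simp: Y')
    also have "\<dots> = S" using U Y by (simp add: partition_on_def)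
    finally show "\<Union>Y' = S" .
    show "{} \<notin> Y'" using * by (auto simp: Y' partition_on_def)
    fix p q assume "p \<in> Y'" "q \<in> Y'" "p \<noteq> q"
    then obtain E F where EF: "E \<in> Y" "p \<in> X E" "F \<in> Y" "q \<in> X F" by (auto simp: Y')
    show "disjnt p q"
    proof (cases "E = F")
      case True
      then show ?thesis using *[of E] EF \<open>p \<noteq> q\<close> by (auto simp: partition_on_def disjoint_def disjnt_def)
    next
      case False
      then have "E \<inter> F = {}" using Y EF by (auto simp: partition_on_def disjoint_def)
      moreover have "p \<subseteq> E" "q \<subseteq> F" using U EF by auto
      ultimately show ?thesis by (auto simp: disjnt_def)
    qed
  qed
qed

text \<open>The last refinement changes nothing, so the blocks are similar with respect to the output itself.\<close>

lemma apr_loop_partition: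
  assumes "apr_loop M \<epsilon> Y X" "0 \<le> \<epsilon>" "partition_on S Y"
  shows "partition_on S X \<and> similar_blocks M \<epsilon> X X"
  using assms
  by (induction rule: apr_loop.induct) (use apr_refine_partition in blast)+

lemma apr_step_eps_quotient:
  assumes M: "is_lmc M" and \<epsilon>: "0 \<le> \<epsilon>" and step: "apr_step \<epsilon> M Q"
  shows "eps_quotient \<epsilon> Q M"
proof -
  obtain X where "apr_output M \<epsilon> X" and iso: "lmc_iso (bisim_quotient (apr_merge M X)) Q"
    using step by (auto simp: apr_step_def)
  then have "apr_loop M \<epsilon> {states M} X" by (simp add: apr_output_def)
  moreover have "partition_on (states M) {states M}"
    using M by (auto simp: is_lmc_def intro: partition_on_space)
  ultimately have X: "partition_on (states M) X" and sim: "similar_blocks M \<epsilon> X X"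
    using apr_loop_partition \<epsilon> by blast+
  have sub: "finite E \<and> E \<noteq> {} \<and> E \<subseteq> states M" if "E \<in> X" for E
    using that X M by (auto simp: partition_on_def is_lmc_def intro: finite_subset)
  show ?thesis
  proof (rule eps_quotient_merge[OF M \<epsilon> _ _ _ _ _ iso, where g = "block_of X"])
    show "labels (apr_merge M X) = labels M" by (simp add: apr_merge_def)
    show "block_of X ` states M = states (apr_merge M X)"
      using block_of_image[OF X] by (simp add: apr_merge_def)
    show "transition_function (states (apr_merge M X)) (tau (apr_merge M X))"
      using sub set_lump[OF X is_lmc_set_tau[OF M]]
      by (fastforce simp: transition_function_def apr_merge_def set_average)
  next
    fix s assume s: "s \<in> states M"
    define E where "E = block_of X s"
    have E: "E \<in> X" "s \<in> E" unfolding E_def using block_of_mem[OF X s] by auto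
    have sim_s: "similar_states M \<epsilon> X u s" if "u \<in> E" for u
      using sim E that by (simp add: similar_blocks_def)
    have "(SOME x. x \<in> E) \<in> E" using E(2) by (rule someI)
    from sim_s[OF this] show "lbl (apr_merge M X) (block_of X s) = lbl M s"
      by (simp add: apr_merge_def similar_states_def flip: E_def)
    \<comment> \<open>With \<open>s\<close> as centre, every member of its block lies within
      \<open>\<epsilon>\<close>, so by convexity the average does too.\<close>
    have "l1_dist X (average_pmf E (\<lambda>u. lump X (tau M u))) (lump X (tau M s)) \<le> \<epsilon>"
    proof (rule l1_dist_average_le)
      fix u assume u: "u \<in> E"
      then have "block_dist X (tau M u) (tau M s) \<le> \<epsilon>"
        using sim_s by (simp add: similar_states_def)
      then show "l1_dist X (lump X (tau M u)) (lump X (tau M s)) \<le> \<epsilon>"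
        using block_dist_eq_l1_dist[OF X] is_lmc_set_tau[OF M] sub[OF E(1)] u s by auto
    qed (use sub[OF E(1)] in auto)
    then show "l1_dist (states (apr_merge M X)) (tau (apr_merge M X) (block_of X s))
        (map_pmf (block_of X) (tau M s)) \<le> \<epsilon>"
      by (simp add: apr_merge_def lump_eq_map_pmf flip: E_def)
  qed
qed

section \<open>Local bisimilarity distance\<close>

text \<open>For reals, \<open>INF\<close> over the empty set would be a junk value.\<close>

lemma local_modifications_nonempty:
  assumes s: "s \<in> states M" and t: "t \<in> states M" and lbl: "lbl M s = lbl M t" and M: "is_lmc M"
  shows "local_modifications M s t \<noteq> {}"
proof -
  \<comment> \<open>Both states receive the same row, so the relation merging only \<open>s\<close>
    and \<open>t\<close> relates states with equal rows and labels.\<close>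
  define \<tau> where "\<tau> = (tau M)(s := return_pmf s, t := return_pmf s)"
  define R where "R = Id_on (states M) \<union> {s, t} \<times> {s, t}"
  have eq: "equiv (states M) R"
  proof (rule equivI)
    show "R \<subseteq> states M \<times> states M" using s t by (auto simp: R_def)
    show "refl_on (states M) R" unfolding refl_on_def R_def by blast
    show "sym R" unfolding sym_def R_def by blast
    show "trans R" unfolding trans_def R_def by blast
  qed
  have "\<tau> x = \<tau> y" if "(x, y) \<in> R" for x y using that by (auto simp: R_def \<tau>_def)
  moreover have "lbl M x = lbl M y" if "(x, y) \<in> R" for x y using that lbl by (auto simp: R_def)
  ultimately have "prob_bisim (M\<lparr>tau := \<tau>\<rparr>) R" using eq by (fastforce simp: prob_bisim_def)
  moreover have "R `` {s} = {s, t}" using s by (auto simp: R_def)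
  then have "{s, t} \<in> states M // R" using quotientI[OF s, of R] by simp
  moreover have "transition_function (states M) \<tau>"
    using M s t by (auto simp: transition_function_def is_lmc_def \<tau>_def)
  moreover have "\<forall>x\<in>states M - {s, t}. \<tau> x = tau M x" by (simp add: \<tau>_def)
  ultimately show ?thesis unfolding local_modifications_def by blast
qed

lemma local_partition_partition:
  assumes M: "is_lmc M"
  shows "partition_on (states M) (local_partition M s t)"
proof -
  have "finite (states (absorbing_lmc M s t))"
    using M by (simp add: absorbing_lmc_def is_lmc_def)
  from bisimilarity_largest(1)[OF this] show ?thesis
    unfolding local_partition_def
    by (intro partition_on_quotient) (simp add: prob_bisim_def absorbing_lmc_def)
qed

text \<open>
  A bisimulation witnessing membership in \<open>local_modifications\<close> is also a bisimulation of
  \<open>absorbing_lmc\<close>, so it refines \<open>local_partition\<close> and \<open>\<tau>\<close> agrees on \<open>s\<close> and \<open>t\<close> for its blocks.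
\<close>

lemma local_modifications_lump_eq:
  assumes M: "is_lmc M" and st: "s \<in> states M" "t \<in> states M"
    and \<tau>: "\<tau> \<in> local_modifications M s t"
  shows "lump (local_partition M s t) (\<tau> s) = lump (local_partition M s t) (\<tau> t)"
proof -
  let ?N = "absorbing_lmc M s t" and ?X = "local_partition M s t"
  obtain R where R: "prob_bisim (M\<lparr>tau := \<tau>\<rparr>) R" and cl: "{s, t} \<in> states M // R"
    and same: "\<And>x. x \<in> states M - {s, t} \<Longrightarrow> \<tau> x = tau M x"
    and tr: "transition_function (states M) \<tau>"
    using \<tau> by (auto simp: local_modifications_def)
  have fin: "finite (states M)" using M by (simp add: is_lmc_def)
  have N: "states ?N = states M" by (simp add: absorbing_lmc_def)
  have eq: "equiv (states M) R" using R by (simp add: prob_bisim_def)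
  have stR: "(s, t) \<in> R" using quotient_eq_iff[OF eq cl cl] by simp
  have iff: "x \<in> E \<longleftrightarrow> y \<in> E" if "(x, y) \<in> R" "E \<in> states M // R" for x y E
    using in_quotient_imp_closed[OF eq that(2)] that(1) eq unfolding equiv_def sym_def by blast
  have "lbl ?N x = lbl ?N y \<and>
      (\<forall>E\<in>states M // R. measure_pmf.prob (tau ?N x) E = measure_pmf.prob (tau ?N y) E)"
    if xy: "(x, y) \<in> R" for x y
  proof (cases "x \<in> {s, t}")
    case True
    then have "y \<in> {s, t}" using iff[OF xy cl] by simp
    then show ?thesis
      using True iff[OF stR] by (auto simp: absorbing_lmc_def indicator_def)
  next
    case False
    then have "y \<notin> {s, t}" using iff[OF xy cl] by simp
    moreover have "x \<in> states M" "y \<in> states M" using xy eq by (auto simp: equiv_def)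
    ultimately have "tau ?N x = \<tau> x" "tau ?N y = \<tau> y" "lbl ?N x = Some (lbl M x)"
      "lbl ?N y = Some (lbl M y)"
      using False same by (auto simp: absorbing_lmc_def)
    then show ?thesis using R xy by (fastforce simp: prob_bisim_def)
  qed
  then have "prob_bisim ?N R" unfolding prob_bisim_def N using eq by blast
  then have sub: "R \<subseteq> bisimilarity ?N" using bisimilarity_largest(2)[of ?N] fin N by simp
  have eqN: "equiv (states M) (bisimilarity ?N)"
    using bisimilarity_largest(1)[of ?N] fin N by (simp add: prob_bisim_def)
  note X = local_partition_partition[OF M, of s t]
  have *: "set_pmf (\<tau> s) \<subseteq> states M" "set_pmf (\<tau> t) \<subseteq> states M"
    using tr st by (auto simp: transition_function_def)
  show ?thesis
  proof (rule pmf_eqI)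
    fix E
    show "pmf (lump ?X (\<tau> s)) E = pmf (lump ?X (\<tau> t)) E"
    proof (cases "E \<in> ?X")
      case True
      then have "E \<in> states M // bisimilarity ?N" by (simp add: local_partition_def)
      \<comment> \<open>A block is a union of \<open>R\<close>-classes, as bisimilarity of the
        absorbing chain contains \<open>R\<close>; equal masses on classes thus extend to
        blocks.\<close>
      then have "E \<subseteq> states M" "R `` E \<subseteq> E"
        using in_quotient_imp_closed[OF eqN] in_quotient_imp_subset[OF eqN] sub by blast+
      then have "measure_pmf.prob (\<tau> s) E = measure_pmf.prob (\<tau> t) E"
        using prob_bisim_closed_set[OF _ R stR] fin by simp
      then show ?thesis using pmf_lump[OF X _ True] * by simp
    next
      case False
      then have "E \<notin> set_pmf (lump ?X (\<tau> s))" "E \<notin> set_pmf (lump ?X (\<tau> t))"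
        using set_lump[OF X] * by blast+
      then show ?thesis by (metis pmf_eq_0_set_pmf)
    qed
  qed
qed

text \<open>Each admissible modification gives \<open>s\<close> and \<open>t\<close> a common block
  distribution. The path through it costs one distance per state, neither enlarged by lumping, hence
  at most twice the maximum; then the infimum is taken.\<close>

lemma l1_dist_lump_le_d_local:
  assumes M: "is_lmc M" and st: "s \<in> states M" "t \<in> states M" and lbl: "lbl M s = lbl M t"
  shows "l1_dist (local_partition M s t) (lump (local_partition M s t) (tau M s))
    (lump (local_partition M s t) (tau M t)) \<le> 2 * d_local M s t"
proof -
  let ?X = "local_partition M s t" and ?S = "states M"
  let ?d = "l1_dist ?X (lump ?X (tau M s)) (lump ?X (tau M t))"
  note X = local_partition_partition[OF M, of s t]
  have fin: "finite ?S" using M by (simp add: is_lmc_def)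
  have "?d / 2 \<le> max (l1_dist ?S (\<tau> s) (tau M s)) (l1_dist ?S (\<tau> t) (tau M t))"
    if \<tau>: "\<tau> \<in> local_modifications M s t" for \<tau>
  proof -
    have le: "l1_dist ?X (lump ?X (\<tau> u)) (lump ?X (tau M u)) \<le> l1_dist ?S (\<tau> u) (tau M u)"
      if "u \<in> ?S" for u
      unfolding lump_eq_map_pmf
      using \<tau> that fin is_lmc_set_tau[OF M that] finite_elements[OF fin X] block_of_image[OF X]
      by (intro l1_dist_map_le) (auto simp: local_modifications_def transition_function_def)
    have "?d \<le> l1_dist ?X (lump ?X (tau M s)) (lump ?X (\<tau> s))
        + l1_dist ?X (lump ?X (\<tau> t)) (lump ?X (tau M t))"
      using l1_dist_triangle[of ?X _ _ "lump ?X (\<tau> s)"]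
      unfolding local_modifications_lump_eq[OF M st \<tau>, symmetric] by simp
    then show ?thesis
      using le[OF st(1)] le[OF st(2)] l1_dist_sym[of ?X "lump ?X (tau M s)"] by simp
  qed
  then have "?d / 2 \<le> d_local M s t"
    unfolding d_local_def using local_modifications_nonempty[OF st lbl M]
    by (intro cINF_greatest) auto
  then show ?thesis by simp
qed

lemma local_step_eps_quotient:
  assumes M: "is_lmc M" and \<epsilon>: "0 \<le> \<epsilon>" and step: "local_step \<epsilon> M Q"
  shows "eps_quotient \<epsilon> Q M"
proof -
  obtain s t u v where "(s, t) \<in> candidate_pairs M" and uv: "(u, v) \<in> candidate_pairs M"
    and "d_local M u v \<le> \<epsilon>"
    and min: "\<forall>(u, v)\<in>candidate_pairs M. d_local M s t \<le> d_local M u v"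
    and iso: "lmc_iso (bisim_quotient (local_merge M s t)) Q"
    using step unfolding local_step_def by blast
  then have st: "s \<in> states M" "t \<in> states M" "s \<noteq> t" "lbl M s = lbl M t"
    by (simp_all add: candidate_pairs_def)
  \<comment> \<open>The loop guard bounds \<open>d_local\<close> at some pair \<open>(u, v)\<close>;
    the bound passes to the merged pair, which is a minimiser.\<close>
  have d: "d_local M s t \<le> \<epsilon>" using bspec[OF min uv] \<open>d_local M u v \<le> \<epsilon>\<close> by simp
  let ?X = "local_partition M s t" and ?N = "local_merge M s t"
  note X = local_partition_partition[OF M, of s t]
  note blk = local_partition_block[OF M st(1,2)]
  have N: "states ?N = ?X" "labels ?N = labels M" by (simp_all add: local_merge_def Let_def)
  have tau_st: "tau ?N {s, t} = average_pmf {s, t} (\<lambda>u. lump ?X (tau M u))"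
    by (simp add: local_merge_def Let_def)
  have some: "(SOME u. u \<in> E) \<in> states M" "(SOME u. u \<in> E) \<in> E" if "E \<in> ?X" for E
  proof -
    have "E \<noteq> {}" "E \<subseteq> states M" using X that by (auto simp: partition_on_def)
    then show "(SOME u. u \<in> E) \<in> E" by (simp add: some_in_eq)
    with \<open>E \<subseteq> states M\<close> show "(SOME u. u \<in> E) \<in> states M" by blast
  qed
  have set: "set_pmf (tau ?N E) \<subseteq> ?X" if "E \<in> ?X" for E
  proof (cases "E = {s, t}")
    case True
    then show ?thesis
      using set_lump[OF X is_lmc_set_tau[OF M]] st by (simp add: tau_st set_average)
  next
    case False
    then show ?thesis
      using set_lump[OF X is_lmc_set_tau[OF M some(1)[OF that]]]
      by (simp add: local_merge_def Let_def)
  qed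
  show ?thesis
  proof (rule eps_quotient_merge[OF M \<epsilon> N(2) _ _ _ _ iso, where g = "block_of ?X"])
    show "block_of ?X ` states M = states ?N" using block_of_image[OF X] N by simp
    show "transition_function (states ?N) (tau ?N)"
      using set by (simp add: transition_function_def N)
  next
    fix u assume u: "u \<in> states M"
    define E where "E = block_of ?X u"
    have E: "E \<in> ?X" "u \<in> E" unfolding E_def using block_of_mem[OF X u] by auto
    have "lbl ?N E = lbl M u \<and> l1_dist ?X (tau ?N E) (lump ?X (tau M u)) \<le> \<epsilon>"
    proof (cases "E = {s, t}")
      case True
      then have "lbl ?N E = lbl M u"
        using some(2)[OF E(1)] E(2) st(4) by (auto simp: local_merge_def Let_def)
      \<comment> \<open>The half from the midpoint cancels the factor 2 of
        \<open>l1_dist_lump_le_d_local\<close>.\<close>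
      moreover have "l1_dist ?X (tau ?N E) (lump ?X (tau M u)) \<le> \<epsilon>"
        using l1_dist_average_pair[OF st(3), of ?X "\<lambda>u. lump ?X (tau M u)"] d
          l1_dist_lump_le_d_local[OF M st(1,2,4)] E(2) True by (auto simp: tau_st)
      ultimately show ?thesis by simp
    next
      case False
      note other = local_merge_other_block[OF M st(1,2) E(1) False E(2)]
      \<comment> \<open>Members of any other block share one block distribution, so no error arises
        there.\<close>
      have "l1_dist ?X (tau ?N E) (lump ?X (tau M u)) = 0"
        unfolding l1_dist_def
        using other(1) pmf_lump[OF X is_lmc_set_tau[OF M u]] by simp
      then show ?thesis using other(2) \<epsilon> by simp
    qed
    then show "lbl ?N (block_of ?X u) = lbl M u"
      "l1_dist (states ?N) (tau ?N (block_of ?X u)) (map_pmf (block_of ?X) (tau M u)) \<le> \<epsilon>"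
      by (simp_all add: E_def N lump_eq_map_pmf)
  qed
qed

section \<open>Accumulation of errors along a run\<close>

theorem theorem7:
  fixes M' :: "('s, 'l) lmc" and \<epsilon>\<^sub>2 :: real
    and Q :: "nat \<Rightarrow> ('q, 'l) lmc" and n :: nat
  assumes "is_lmc M'" and "\<epsilon>\<^sub>2 > 0"
    and "local_run \<epsilon>\<^sub>2 M' n Q \<or> apr_run \<epsilon>\<^sub>2 M' n Q"
  shows "(\<forall>i<n. eps_quotient \<epsilon>\<^sub>2 (Q (Suc i)) (Q i)) \<and>
         (\<forall>i\<le>n. eps_quotient (real i * \<epsilon>\<^sub>2) (Q i) M')"
proof -
  have Q0: "eps_quotient 0 (Q 0) M'"
    using assms by (intro eps_quotient_0) (auto simp: local_run_def apr_run_def)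
  have step: "eps_quotient \<epsilon>\<^sub>2 (Q (Suc i)) (Q i)" if "i < n" "is_lmc (Q i)" for i
    using that assms local_step_eps_quotient[of "Q i" \<epsilon>\<^sub>2] apr_step_eps_quotient[of "Q i" \<epsilon>\<^sub>2]
    by (auto simp: local_run_def apr_run_def)
  \<comment> \<open>The step lemmas require a well-formed chain; this is carried along the run
    because \<open>eps_quotient\<close> includes it for the new chain.\<close>
  have lmc: "is_lmc (Q i)" if "i \<le> n" for i
    using that
  proof (induction i)
    case 0
    then show ?case using Q0 by (simp add: eps_quotient_def)
  next
    case (Suc i)
    then show ?case using step[of i] by (simp add: eps_quotient_def)
  qed
  have "eps_quotient (real i * \<epsilon>\<^sub>2) (Q i) M'" if "i \<le> n" for i
    using that
  proof (induction i)
    case 0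
    then show ?case using Q0 by simp
  next
    case (Suc i)
    then have "eps_quotient (real i * \<epsilon>\<^sub>2 + \<epsilon>\<^sub>2) (Q (Suc i)) M'"
      using eps_quotient_trans[OF assms(1)] step[of i] lmc[of i] by simp
    then show ?case by (simp add: algebra_simps)
  qed
  then show ?thesis using step lmc by simp
qed

end
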